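(* (a) For every integer $k \ge 2$, a random walk on the infinite $k$-regular tree produces a discrete hypergroup. (b) A random walk on the Cayley graph $\mathrm{Cay}\big(\mathbb{Z}\oplus(\mathbb{Z}/2\mathbb{Z}),\{(\pm 1,\overline{0}),(0,\overline{1})\}\big)$ produces a discrete hypergroup, where $\overline{0},\overline{1}$ denote the residue classes of $0,1$ modulo $2$.
   Context: **Discrete hypergroup.** For a set $K$, let $\mathbb{C}K$ be the free complex vector space on $K$; for $\mu\in\mathbb{C}K$ let $\mu(x)$ be the coefficient of $x\in K$, $\|\mu\|_1=\sum_{x}|\mu(x)|$, $\mathrm{supp}(\mu)=\{x\in K: \mu(x)\ne 0\}$. $K$, with a bilinear convolution $\circ:\mathbb{C}K\times\mathbb{C}K\to\mathbb{C}K$ and a map $*:\mathbb{C}K\to\mathbb{C}K$, is a discrete hypergroup if: (i) $(\mathbb{C}K,\circ,* )$ is an associative $*$-algebra ($*$ is conjugate-linear, involutive and anti-multiplicative) with a neutral element $e\in K$; (ii) for all $x,y,z\in K$, $(x\circ y)(z)\ge 0$ is real, and $\|x\circ y\|_1=1$; (iii) $*$ maps $K$ onto $K$; (iv) for $x,y\in K$, $e\in\mathrm{supp}(x\circ y)$ if and only if $y=x^*$. **Construction from a graph.** Let $X=(V,E)$ be a connected simple graph all of whose vertices have finite degree, with graph distance $d$; $\mathrm{diam}(X)\in\mathbb{N}_0\cup\{\infty\}$ is the supremum of distances. Let $I=\{i\in\mathbb{N}_0: i\le \mathrm{diam}(X)\}$, $R_i=\{(v,w)\in V\times V: d(v,w)=i\}$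 for $i \in I$, $\mathcal{R}(X)=\{R_i\}_{i\in I}$, and $\Gamma_i(v)=\{w\in V: d(v,w)=i\}$. For a base point $v_0\in V$ put $$P_{i,j}^k=\frac{1}{|\Gamma_i(v_0)|}\sum_{v\in\Gamma_i(v_0)}\frac{|\Gamma_j(v)\cap\Gamma_k(v_0)|}{|\Gamma_j(v)|}\qquad(i,j,k\in I),$$ provided no denominator vanishes. Define the bilinear convolution $\circ_{v_0}$ on $\mathbb{C}\mathcal{R}(X)$ by $R_i\circ_{v_0}R_j=\sum_{k\in I}P_{i,j}^kR_k$, and let $*$ be the conjugate-linear map on $\mathbb{C}\mathcal{R}(X)$ fixing every $R_i$. "A random walk on $X$ produces a discrete hypergroup" means: for every $v_0\in V$, the $P_{i,j}^k$ are all well-defined and $\mathcal{R}(X)$ with $\circ_{v_0}$ and $*$ is a discrete hypergroup (automatically hermitian, i.e. $*$ restricts to the identity on $\mathcal{R}(X)$). **Graphs.** The infinite $k$-regular tree is the connected infinite graph without cycles in which every vertex has degree $k$ (unique up to isomorphism). For a group $G$ and an inverse-closed $\Omega\subset G\setminus\{1_G\}$, $\mathrm{Cay}(G,\Omega)$ has vertex set $G$ and edges $\{g,h\}$ with $g^{-1}h\in\Omega$. *)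

theory Defs
  imports Complex_Main "HOL-Library.Extended_Nat" "HOL-Library.Nonpos_Ints"
    "HOL-Library.Poly_Mapping" "HOL-Algebra.Elementary_Groups"
begin

section \<open>Discrete hypergroups\<close>

text \<open>The free complex vector space on a set \<open>K\<close> consists of the finitely supported functions
  with support in \<open>K\<close>; addition is that of \<open>\<Rightarrow>\<^sub>0\<close>, and \<open>keys\<close> is the support.\<close>

definition free_vs :: "'a set \<Rightarrow> ('a \<Rightarrow>\<^sub>0 complex) set" where
  "free_vs K = {\<mu>. Poly_Mapping.keys \<mu> \<subseteq> K}"

definition scale :: "complex \<Rightarrow> ('a \<Rightarrow>\<^sub>0 complex) \<Rightarrow> ('a \<Rightarrow>\<^sub>0 complex)" where
  "scale c \<mu> = Poly_Mapping.map (\<lambda>z. c * z) \<mu>"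

definition basis :: "'a \<Rightarrow> ('a \<Rightarrow>\<^sub>0 complex)" where
  "basis x = Poly_Mapping.single x 1"

definition norm1 :: "('a \<Rightarrow>\<^sub>0 complex) \<Rightarrow> real" where
  "norm1 \<mu> = (\<Sum>x\<in>Poly_Mapping.keys \<mu>. cmod (Poly_Mapping.lookup \<mu> x))"

locale discrete_hypergroup =
  fixes K :: "'a set"
    and conv :: "('a \<Rightarrow>\<^sub>0 complex) \<Rightarrow> ('a \<Rightarrow>\<^sub>0 complex) \<Rightarrow> ('a \<Rightarrow>\<^sub>0 complex)" (infixl "\<diamondop>" 70)
    and star :: "('a \<Rightarrow>\<^sub>0 complex) \<Rightarrow> ('a \<Rightarrow>\<^sub>0 complex)"
    and e :: 'a
  assumes conv_closed: "\<lbrakk>\<mu> \<in> free_vs K; \<nu> \<in> free_vs K\<rbrakk> \<Longrightarrow> \<mu> \<diamondop> \<nu> \<in> free_vs K"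
    and conv_add_left: "\<lbrakk>\<mu> \<in> free_vs K; \<mu>' \<in> free_vs K; \<nu> \<in> free_vs K\<rbrakk> \<Longrightarrow>
      (\<mu> + \<mu>') \<diamondop> \<nu> = \<mu> \<diamondop> \<nu> + \<mu>' \<diamondop> \<nu>"
    and conv_add_right: "\<lbrakk>\<mu> \<in> free_vs K; \<nu> \<in> free_vs K; \<nu>' \<in> free_vs K\<rbrakk> \<Longrightarrow>
      \<mu> \<diamondop> (\<nu> + \<nu>') = \<mu> \<diamondop> \<nu> + \<mu> \<diamondop> \<nu>'"
    and conv_scale_left: "\<lbrakk>\<mu> \<in> free_vs K; \<nu> \<in> free_vs K\<rbrakk> \<Longrightarrow>
      scale c \<mu> \<diamondop> \<nu> = scale c (\<mu> \<diamondop> \<nu>)"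
    and conv_scale_right: "\<lbrakk>\<mu> \<in> free_vs K; \<nu> \<in> free_vs K\<rbrakk> \<Longrightarrow>
      \<mu> \<diamondop> scale c \<nu> = scale c (\<mu> \<diamondop> \<nu>)"
    and conv_assoc: "\<lbrakk>\<mu> \<in> free_vs K; \<nu> \<in> free_vs K; \<rho> \<in> free_vs K\<rbrakk> \<Longrightarrow>
      (\<mu> \<diamondop> \<nu>) \<diamondop> \<rho> = \<mu> \<diamondop> (\<nu> \<diamondop> \<rho>)"
    and star_closed: "\<mu> \<in> free_vs K \<Longrightarrow> star \<mu> \<in> free_vs K"
    and star_add: "\<lbrakk>\<mu> \<in> free_vs K; \<nu> \<in> free_vs K\<rbrakk> \<Longrightarrow> star (\<mu> + \<nu>) = star \<mu> + star \<nu>"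
    and star_scale: "\<mu> \<in> free_vs K \<Longrightarrow> star (scale c \<mu>) = scale (cnj c) (star \<mu>)"
    and star_star: "\<mu> \<in> free_vs K \<Longrightarrow> star (star \<mu>) = \<mu>"
    and star_conv: "\<lbrakk>\<mu> \<in> free_vs K; \<nu> \<in> free_vs K\<rbrakk> \<Longrightarrow> star (\<mu> \<diamondop> \<nu>) = star \<nu> \<diamondop> star \<mu>"
    and e_in: "e \<in> K"
    and conv_e_left: "\<mu> \<in> free_vs K \<Longrightarrow> basis e \<diamondop> \<mu> = \<mu>"
    and conv_e_right: "\<mu> \<in> free_vs K \<Longrightarrow> \<mu> \<diamondop> basis e = \<mu>"
    and conv_nonneg: "\<lbrakk>x \<in> K; y \<in> K; z \<in> K\<rbrakk> \<Longrightarrow>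
      Poly_Mapping.lookup (basis x \<diamondop> basis y) z \<in> \<real>\<^sub>\<ge>\<^sub>0"
    and conv_norm1: "\<lbrakk>x \<in> K; y \<in> K\<rbrakk> \<Longrightarrow> norm1 (basis x \<diamondop> basis y) = 1"
    and star_onto: "star ` basis ` K = basis ` K"
    and e_in_supp_iff: "\<lbrakk>x \<in> K; y \<in> K\<rbrakk> \<Longrightarrow>
      e \<in> Poly_Mapping.keys (basis x \<diamondop> basis y) \<longleftrightarrow> basis y = star (basis x)"


section \<open>Graphs\<close>

datatype 'v ugraph = UGraph (verts: "'v set") (edges: "'v set set")

definition simple_graph :: "'v ugraph \<Rightarrow> bool" where
  "simple_graph X \<longleftrightarrow> (\<forall>f\<in>edges X. f \<subseteq> verts X \<and> card f = 2)"

text \<open>A walk is given by its nonempty list of vertices.\<close>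

definition walk :: "'v ugraph \<Rightarrow> 'v list \<Rightarrow> bool" where
  "walk X p \<longleftrightarrow> p \<noteq> [] \<and> set p \<subseteq> verts X \<and> successively (\<lambda>u v. {u, v} \<in> edges X) p"

definition connected_graph :: "'v ugraph \<Rightarrow> bool" where
  "connected_graph X \<longleftrightarrow> verts X \<noteq> {} \<and>
     (\<forall>v\<in>verts X. \<forall>w\<in>verts X. \<exists>p. walk X p \<and> hd p = v \<and> last p = w)"

definition neighbours :: "'v ugraph \<Rightarrow> 'v \<Rightarrow> 'v set" where
  "neighbours X v = {w \<in> verts X. {v, w} \<in> edges X}"

definition locally_finite :: "'v ugraph \<Rightarrow> bool" where
  "locally_finite X \<longleftrightarrow> (\<forall>v\<in>verts X. finite (neighbours X v))"

definition regular_graph :: "nat \<Rightarrow> 'v ugraph \<Rightarrow> bool" where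
  "regular_graph k X \<longleftrightarrow>
     (\<forall>v\<in>verts X. finite (neighbours X v) \<and> card (neighbours X v) = k)"

definition is_cycle :: "'v ugraph \<Rightarrow> 'v list \<Rightarrow> bool" where
  "is_cycle X p \<longleftrightarrow> walk X p \<and> distinct p \<and> 3 \<le> length p \<and> {last p, hd p} \<in> edges X"

definition infinite_regular_tree :: "nat \<Rightarrow> 'v ugraph \<Rightarrow> bool" where
  "infinite_regular_tree k X \<longleftrightarrow> simple_graph X \<and> connected_graph X \<and> infinite (verts X) \<and>
     (\<nexists>p. is_cycle X p) \<and> regular_graph k X"

definition Cay :: "('g, 'm) monoid_scheme \<Rightarrow> 'g set \<Rightarrow> 'g ugraph" where
  "Cay G \<Omega> = UGraph (carrier G)
     {{g, h} | g h. g \<in> carrier G \<and> h \<in> carrier G \<and> inv\<^bsub>G\<^esub> g \<otimes>\<^bsub>G\<^esub> h \<in> \<Omega>}"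

text \<open>Only meaningful for vertices joined by a walk.\<close>

definition gdist :: "'v ugraph \<Rightarrow> 'v \<Rightarrow> 'v \<Rightarrow> nat" where
  "gdist X v w = (LEAST n. \<exists>p. walk X p \<and> hd p = v \<and> last p = w \<and> length p = Suc n)"

definition diam :: "'v ugraph \<Rightarrow> enat" where
  "diam X = (SUP (v, w)\<in>verts X \<times> verts X. enat (gdist X v w))"


section \<open>Random walks and hypergroups\<close>

definition indices :: "'v ugraph \<Rightarrow> nat set" where
  "indices X = {i. enat i \<le> diam X}"

definition Rel :: "'v ugraph \<Rightarrow> nat \<Rightarrow> ('v \<times> 'v) set" where
  "Rel X i = {(v, w). v \<in> verts X \<and> w \<in> verts X \<and> gdist X v w = i}"

definition Rels :: "'v ugraph \<Rightarrow> ('v \<times> 'v) set set" where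
  "Rels X = Rel X ` indices X"

definition Gam :: "'v ugraph \<Rightarrow> nat \<Rightarrow> 'v \<Rightarrow> 'v set" where
  "Gam X i v = {w \<in> verts X. gdist X v w = i}"

definition P :: "'v ugraph \<Rightarrow> 'v \<Rightarrow> nat \<Rightarrow> nat \<Rightarrow> nat \<Rightarrow> real" where
  "P X v\<^sub>0 i j k = 1 / real (card (Gam X i v\<^sub>0)) *
     (\<Sum>v\<in>Gam X i v\<^sub>0. real (card (Gam X j v \<inter> Gam X k v\<^sub>0)) / real (card (Gam X j v)))"

text \<open>As \<open>card\<close> is \<open>0\<close> on infinite sets, this also makes all the cardinalities finite.\<close>

definition P_well_defined :: "'v ugraph \<Rightarrow> 'v \<Rightarrow> bool" where
  "P_well_defined X v\<^sub>0 \<longleftrightarrow> (\<forall>i\<in>indices X. card (Gam X i v\<^sub>0) \<noteq> 0 \<and>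
     (\<forall>v\<in>Gam X i v\<^sub>0. \<forall>j\<in>indices X. card (Gam X j v) \<noteq> 0))"

text \<open>The bilinear extension of \<open>R\<^sub>i \<circ> R\<^sub>j = (\<Sum>k. P i j k R\<^sub>k)\<close>. The sums omit zero terms because
  \<open>indices X\<close> may be infinite and \<open>sum\<close> is \<open>0\<close> on infinite sets; the remaining index sets are
  finite for connected \<open>X\<close>: \<open>i \<mapsto> R\<^sub>i\<close> is injective on \<open>indices X\<close>, and \<open>P i j k = 0\<close> for \<open>k > i + j\<close>.\<close>

definition rw_conv :: "'v ugraph \<Rightarrow> 'v \<Rightarrow> (('v \<times> 'v) set \<Rightarrow>\<^sub>0 complex) \<Rightarrow>
    (('v \<times> 'v) set \<Rightarrow>\<^sub>0 complex) \<Rightarrow> (('v \<times> 'v) set \<Rightarrow>\<^sub>0 complex)" where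
  "rw_conv X v\<^sub>0 \<mu> \<nu> =
     (\<Sum>i\<in>{i \<in> indices X. Rel X i \<in> Poly_Mapping.keys \<mu>}.
      \<Sum>j\<in>{j \<in> indices X. Rel X j \<in> Poly_Mapping.keys \<nu>}.
        scale (Poly_Mapping.lookup \<mu> (Rel X i) * Poly_Mapping.lookup \<nu> (Rel X j))
          (\<Sum>k\<in>{k \<in> indices X. P X v\<^sub>0 i j k \<noteq> 0}.
             scale (complex_of_real (P X v\<^sub>0 i j k)) (basis (Rel X k))))"

text \<open>The conjugate-linear map fixing every basis vector conjugates the coefficients.\<close>

definition rw_star :: "('a \<Rightarrow>\<^sub>0 complex) \<Rightarrow> ('a \<Rightarrow>\<^sub>0 complex)" where
  "rw_star \<mu> = Poly_Mapping.map cnj \<mu>"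

definition random_walk_produces_hypergroup :: "'v ugraph \<Rightarrow> bool" where
  "random_walk_produces_hypergroup X \<longleftrightarrow>
     simple_graph X \<and> connected_graph X \<and> locally_finite X \<and>
     (\<forall>v\<^sub>0\<in>verts X. P_well_defined X v\<^sub>0 \<and>
        (\<exists>e. discrete_hypergroup (Rels X) (rw_conv X v\<^sub>0) rw_star e))"

end

theory Submission
  imports Defs
begin

text \<open>Fix a base point \<open>v\<^sub>0\<close>. Averaging a radial function \<open>\<phi> (d v\<^sub>0 _)\<close> over spheres of radius \<open>j\<close> and then
  over the spheres around \<open>v\<^sub>0\<close> gives an operator \<open>T\<^sub>j\<close> on functions of the radius, whose matrix entries
  are \<open>(T\<^sub>j \<phi>) i = (\<Sum>k. P i j k * \<phi> k)\<close>. Since \<open>(T\<^sub>j \<phi>) 0 = \<phi> j\<close>, commutation of the \<open>T\<^sub>j\<close> already makes the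
  convolution commutative and associative; the other hypergroup axioms hold whenever all spheres are
  finite and nonempty. Commutation follows from a three-term recurrence that expresses \<open>T\<^bsub>j+2\<^esub>\<close> through
  \<open>T\<^sub>1 T\<^bsub>j+1\<^esub>\<close> and \<open>T\<^sub>j\<close>. On a tree all but one neighbour of a vertex lie farther from a given other vertex,
  which gives the recurrence \<open>k T\<^sub>1 T\<^bsub>j+1\<^esub> = (k - 1) T\<^bsub>j+2\<^esub> + T\<^sub>j\<close>. On the ladder, where spheres around
  different points do not average radial functions to radial functions, explicit formulas for
  \<open>T\<^sub>j\<close> give \<open>3 T\<^sub>1 T\<^sub>1 = 2 T\<^sub>2 + T\<^sub>0\<close> and \<open>2 T\<^sub>1 T\<^bsub>j+1\<^esub> = T\<^bsub>j+2\<^esub> + T\<^sub>j\<close> for \<open>j \<ge> 1\<close>.\<close>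

section \<open>Distances in connected graphs\<close>

lemma walk_Cons:
  "walk X (v # p) \<longleftrightarrow> v \<in> verts X \<and> (p = [] \<or> {v, hd p} \<in> edges X \<and> walk X p)"
  by (auto simp: walk_def successively_Cons)

lemma walk_append:
  "walk X p \<Longrightarrow> walk X q \<Longrightarrow> last p = hd q \<Longrightarrow> walk X (p @ tl q)"
  by (cases q) (auto simp: walk_def successively_append_iff successively_Cons)

lemma walk_rev: "walk X p \<Longrightarrow> walk X (rev p)"
  by (auto simp: walk_def successively_rev insert_commute)

lemma walk_endpoints: "walk X p \<Longrightarrow> hd p \<in> verts X" "walk X p \<Longrightarrow> last p \<in> verts X"
  by (auto simp: walk_def)

lemma gdist_le_walk: "walk X p \<Longrightarrow> gdist X (hd p) (last p) \<le> length p - 1"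
  unfolding gdist_def by (rule Least_le) (auto simp: walk_def neq_Nil_conv)

lemma gdist_walk:
  assumes "connected_graph X" "v \<in> verts X" "w \<in> verts X"
  obtains p where "walk X p" "hd p = v" "last p = w" "length p = Suc (gdist X v w)"
proof -
  obtain q where "walk X q" "hd q = v" "last q = w"
    using assms by (auto simp: connected_graph_def)
  then have "\<exists>n p. walk X p \<and> hd p = v \<and> last p = w \<and> length p = Suc n"
    by (metis walk_def length_Suc_conv neq_Nil_conv)
  from LeastI_ex[OF this] show ?thesis
    using that unfolding gdist_def by blast
qed

lemma gdist_self: "v \<in> verts X \<Longrightarrow> gdist X v v = 0"
  using gdist_le_walk[of X "[v]"] by (simp add: walk_def)

lemma gdist_eq_0_iff:
  assumes "connected_graph X" "v \<in> verts X" "w \<in> verts X"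
  shows "gdist X v w = 0 \<longleftrightarrow> v = w"
proof
  assume "gdist X v w = 0"
  with gdist_walk[OF assms] obtain p where "hd p = v" "last p = w" "length p = 1"
    by (metis One_nat_def)
  then show "v = w" by (auto simp: length_Suc_conv)
qed (use assms gdist_self in auto)

lemma gdist_sym:
  assumes "connected_graph X" "v \<in> verts X" "w \<in> verts X"
  shows "gdist X v w = gdist X w v"
proof -
  have *: "gdist X b a \<le> gdist X a b" if ab: "a \<in> verts X" "b \<in> verts X" for a b
  proof -
    obtain p where "walk X p" "hd p = a" "last p = b" "length p = Suc (gdist X a b)"
      using gdist_walk[OF assms(1) ab] .
    then show ?thesis
      using gdist_le_walk[OF walk_rev, of X p] by (simp add: hd_rev last_rev)
  qed
  show ?thesis using *[of v w] *[of w v] assms by simp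
qed

lemma gdist_triangle:
  assumes "connected_graph X" "u \<in> verts X" "v \<in> verts X" "w \<in> verts X"
  shows "gdist X u w \<le> gdist X u v + gdist X v w"
proof -
  obtain p where p: "walk X p" "hd p = u" "last p = v" "length p = Suc (gdist X u v)"
    using gdist_walk assms by metis
  obtain q where q: "walk X q" "hd q = v" "last q = w" "length q = Suc (gdist X v w)"
    using gdist_walk assms by metis
  have "hd (p @ tl q) = u" "last (p @ tl q) = w"
    using p q by (cases q; force simp: walk_def)+
  then show ?thesis
    using gdist_le_walk[OF walk_append[OF p(1) q(1)]] p q by simp
qed

lemma gdist_neighbour:
  assumes "connected_graph X" "v \<in> verts X" "u \<in> neighbours X v" "w \<in> verts X"
  shows "gdist X u w \<le> Suc (gdist X v w)" "gdist X v w \<le> Suc (gdist X u w)"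
proof -
  have u: "u \<in> verts X" "{u, v} \<in> edges X" "{v, u} \<in> edges X"
    using assms by (auto simp: neighbours_def insert_commute)
  have "gdist X u v \<le> 1" "gdist X v u \<le> 1"
    using gdist_le_walk[of X "[u, v]"] gdist_le_walk[of X "[v, u]"] u assms
    by (auto simp: walk_def)
  then show "gdist X u w \<le> Suc (gdist X v w)" "gdist X v w \<le> Suc (gdist X u w)"
    using gdist_triangle[of X u v w] gdist_triangle[of X v u w] assms u by force+
qed

lemma gdist_descent:
  assumes "connected_graph X" "v \<in> verts X" "w \<in> verts X" "gdist X v w = Suc n"
  obtains u where "u \<in> neighbours X v" "gdist X u w = n"
proof -
  obtain p where p: "walk X p" "hd p = v" "last p = w" "length p = Suc (Suc n)"
    using gdist_walk[OF assms(1-3)] assms(4) by metis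
  then obtain u q where pq: "p = v # u # q"
    by (auto simp: length_Suc_conv)
  have u: "u \<in> neighbours X v" and q: "walk X (u # q)" "last (u # q) = w"
    using p pq by (auto simp: neighbours_def walk_def)
  have "gdist X u w \<le> n" using gdist_le_walk[OF q(1)] q p pq by simp
  moreover have "Suc n \<le> Suc (gdist X u w)"
    using gdist_neighbour(2)[OF assms(1,2) u assms(3)] assms(4) by simp
  ultimately show ?thesis using that u by simp
qed

lemma neighbours_eq_Gam_1:
  assumes "simple_graph X" "connected_graph X" "v \<in> verts X"
  shows "neighbours X v = Gam X 1 v"
proof (intro equalityI subsetI)
  fix u assume u: "u \<in> neighbours X v"
  \<comment> \<open>Edges have two elements, so loops are excluded.\<close>
  then have "u \<noteq> v" using assms by (auto simp: neighbours_def simple_graph_def)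
  moreover have uv: "u \<in> verts X" using u by (auto simp: neighbours_def)
  ultimately have "gdist X v u \<noteq> 0" using gdist_eq_0_iff assms by metis
  moreover have "gdist X v u \<le> Suc (gdist X u u)"
    using gdist_neighbour(2)[OF assms(2,3) u uv] .
  ultimately show "u \<in> Gam X 1 v" using uv by (simp add: Gam_def gdist_self)
next
  fix u assume "u \<in> Gam X 1 v"
  then have u: "u \<in> verts X" "gdist X v u = Suc 0" by (auto simp: Gam_def)
  then obtain x where "x \<in> neighbours X v" "gdist X x u = 0"
    using gdist_descent[OF assms(2,3) u] by metis
  then show "u \<in> neighbours X v"
    using gdist_eq_0_iff[OF assms(2), of x u] u by (auto simp: neighbours_def)
qed

lemma Gam_subset_verts: "Gam X i v \<subseteq> verts X"
  by (auto simp: Gam_def)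

lemma Gam_0:
  assumes "connected_graph X" "v \<in> verts X"
  shows "Gam X 0 v = {v}"
  using assms gdist_eq_0_iff[OF assms] by (auto simp: Gam_def)

text \<open>By descent, a sphere of radius \<open>Suc i\<close> is covered by the spheres of radius
  \<open>i\<close> around the finitely many neighbours of its centre.\<close>

lemma finite_Gam:
  assumes "connected_graph X" "locally_finite X" "v \<in> verts X"
  shows "finite (Gam X i v)"
  using assms(3)
proof (induction i arbitrary: v)
  case 0
  then show ?case using Gam_0[OF assms(1)] by simp
next
  case (Suc i)
  have "Gam X (Suc i) v \<subseteq> (\<Union>u\<in>neighbours X v. Gam X i u)"
  proof
    fix w assume "w \<in> Gam X (Suc i) v"
    then have w: "w \<in> verts X" "gdist X v w = Suc i" by (auto simp: Gam_def)
    then obtain u where "u \<in> neighbours X v" "gdist X u w = i"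
      using gdist_descent[OF assms(1) Suc.prems] by metis
    then show "w \<in> (\<Union>u\<in>neighbours X v. Gam X i u)" using w by (auto simp: Gam_def)
  qed
  moreover have "finite (\<Union>u\<in>neighbours X v. Gam X i u)"
    using Suc assms by (auto simp: locally_finite_def neighbours_def)
  ultimately show ?case by (rule finite_subset)
qed

text \<open>This certifies an explicit distance formula. The condition \<open>edge\<close> bounds
  the length of every walk from below by \<open>D\<close>, and repeated \<open>descent\<close>
  builds a walk of exactly that length. The walks are kept as a second conclusion because
  connectedness of the ladder is read off from them.\<close>

lemma gdist_eqI:
  fixes D :: "'v \<Rightarrow> 'v \<Rightarrow> nat"
  assumes D0: "\<And>v w. v \<in> verts X \<Longrightarrow> w \<in> verts X \<Longrightarrow> D v w = 0 \<longleftrightarrow> v = w"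
    and edge: "\<And>u v w. v \<in> verts X \<Longrightarrow> u \<in> neighbours X v \<Longrightarrow> w \<in> verts X \<Longrightarrow> D v w \<le> Suc (D u w)"
    and descent: "\<And>v w n. v \<in> verts X \<Longrightarrow> w \<in> verts X \<Longrightarrow> D v w = Suc n \<Longrightarrow>
      \<exists>u\<in>neighbours X v. D u w = n"
    and vw: "v \<in> verts X" "w \<in> verts X"
  shows "gdist X v w = D v w" "\<exists>p. walk X p \<and> hd p = v \<and> last p = w"
proof -
  have lower: "D (hd p) (last p) \<le> length p - 1" if "walk X p" for p
    using that
  proof (induction p)
    case (Cons v p)
    show ?case
    proof (cases "p = []")
      case True
      then show ?thesis using D0[of v v] Cons.prems by (simp add: walk_def)
    next
      case False
      then have p: "walk X p" "v \<in> verts X" "hd p \<in> neighbours X v"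
        using Cons.prems walk_endpoints by (auto simp: walk_Cons neighbours_def)
      then have "D v (last p) \<le> Suc (D (hd p) (last p))"
        using edge walk_endpoints by metis
      also have "\<dots> \<le> length p"
        using Cons.IH p(1) False by (cases p) auto
      finally show ?thesis using False by simp
    qed
  qed (simp add: walk_def)
  have upper: "\<exists>p. walk X p \<and> hd p = v \<and> last p = w \<and> length p = Suc n"
    if "v \<in> verts X" "D v w = n" for v n
    using that
  proof (induction n arbitrary: v)
    case 0
    then show ?case using D0 vw by (intro exI[of _ "[v]"]) (simp add: walk_def)
  next
    case (Suc n)
    then obtain u where u: "u \<in> neighbours X v" "D u w = n" using descent vw by metis
    then obtain p where "walk X p" "hd p = u" "last p = w" "length p = Suc n"
      using Suc.IH[of u] by (auto simp: neighbours_def)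
    then show ?case using u Suc.prems
      by (intro exI[of _ "v # p"]) (auto simp: walk_Cons neighbours_def)
  qed
  obtain p where p: "walk X p" "hd p = v" "last p = w" "length p = Suc (D v w)"
    using upper vw by blast
  then show "\<exists>p. walk X p \<and> hd p = v \<and> last p = w" by blast
  show "gdist X v w = D v w"
    unfolding gdist_def
  proof (rule Least_equality)
    fix n assume "\<exists>p. walk X p \<and> hd p = v \<and> last p = w \<and> length p = Suc n"
    then show "D v w \<le> n" using lower by force
  qed (use p in blast)
qed

section \<open>Spherical means\<close>

definition sphere_mean :: "'v ugraph \<Rightarrow> nat \<Rightarrow> ('v \<Rightarrow> real) \<Rightarrow> 'v \<Rightarrow> real" where
  "sphere_mean X j f v = (\<Sum>w\<in>Gam X j v. f w) / real (card (Gam X j v))"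

text \<open>The operator \<open>T\<^sub>j\<close> for the base point \<open>v\<^sub>0\<close>. The
  inner mean of a radial function may fail to be radial; the outer mean over the sphere of radius
  \<open>i\<close> around \<open>v\<^sub>0\<close> turns it back into a function of the
  radius.\<close>

definition radial_mean :: "'v ugraph \<Rightarrow> 'v \<Rightarrow> nat \<Rightarrow> (nat \<Rightarrow> real) \<Rightarrow> nat \<Rightarrow> real" where
  "radial_mean X v\<^sub>0 j \<phi> i = sphere_mean X i (sphere_mean X j (\<lambda>w. \<phi> (gdist X v\<^sub>0 w))) v\<^sub>0"

lemma sphere_mean_cong:
  "(\<And>w. w \<in> Gam X j v \<Longrightarrow> f w = g w) \<Longrightarrow> sphere_mean X j f v = sphere_mean X j g v"
  by (simp add: sphere_mean_def)

lemma sphere_mean_linear: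
  "sphere_mean X j (\<lambda>w. a * f w + b * g w) =
     (\<lambda>v. a * sphere_mean X j f v + b * sphere_mean X j g v)"
  by (simp add: fun_eq_iff sphere_mean_def sum.distrib sum_distrib_left add_divide_distrib)

lemma sphere_mean_sum:
  "sphere_mean X j (\<lambda>w. \<Sum>k\<in>K. f k w) =
     (\<lambda>v. \<Sum>k\<in>K. sphere_mean X j (f k) v)"
  unfolding sphere_mean_def sum_divide_distrib by (rule ext, rule sum.swap)

lemma sphere_mean_cmult:
  "sphere_mean X j (\<lambda>w. a * f w) = (\<lambda>v. a * sphere_mean X j f v)"
  by (simp add: fun_eq_iff sphere_mean_def sum_distrib_left)

lemma radial_mean_linear:
  "radial_mean X v\<^sub>0 j (\<lambda>l. a * \<phi> l + b * \<psi> l) =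
     (\<lambda>i. a * radial_mean X v\<^sub>0 j \<phi> i + b * radial_mean X v\<^sub>0 j \<psi> i)"
  by (simp add: fun_eq_iff radial_mean_def sphere_mean_linear)

text \<open>Nonempty spheres of every radius make the diameter infinite, so every natural number is
  an index and the relations \<open>Rel X i\<close> are pairwise distinct. Together with local
  finiteness they make all sphere sizes legitimate denominators.\<close>

locale spherical_graph =
  fixes X :: "'v ugraph"
  assumes simple: "simple_graph X"
    and conn: "connected_graph X"
    and loc_finite: "locally_finite X"
    and Gam_nonempty: "v \<in> verts X \<Longrightarrow> Gam X i v \<noteq> {}"
begin

lemma indices_UNIV: "indices X = UNIV"
proof -
  obtain v where v: "v \<in> verts X" using conn by (auto simp: connected_graph_def)
  have "enat i \<le> diam X" for i
  proof -
    obtain w where "w \<in> verts X" "gdist X v w = i"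
      using Gam_nonempty[OF v, of i] by (auto simp: Gam_def)
    then show ?thesis
      unfolding diam_def using v by (intro SUP_upper2[of "(v, w)"]) auto
  qed
  then show ?thesis by (auto simp: indices_def)
qed

lemma Rel_inject: "Rel X i = Rel X j \<longleftrightarrow> i = j"
proof
  assume eq: "Rel X i = Rel X j"
  obtain v where v: "v \<in> verts X" using conn by (auto simp: connected_graph_def)
  obtain w where "w \<in> Gam X i v" using Gam_nonempty[OF v, of i] by auto
  then have "(v, w) \<in> Rel X i" using v by (auto simp: Gam_def Rel_def)
  moreover from this have "(v, w) \<in> Rel X j" using eq by simp
  ultimately show "i = j" by (auto simp: Rel_def)
qed simp

lemma Rels_eq: "Rels X = range (Rel X)"
  by (simp add: Rels_def indices_UNIV)

lemma card_Gam_pos: "v \<in> verts X \<Longrightarrow> card (Gam X i v) > 0"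
  using finite_Gam[OF conn loc_finite] Gam_nonempty by (simp add: card_gt_0_iff)

lemma card_Gam_nonzero: "v \<in> verts X \<Longrightarrow> card (Gam X i v) \<noteq> 0"
  using card_Gam_pos by simp

lemma sphere_mean_const: "v \<in> verts X \<Longrightarrow> sphere_mean X j (\<lambda>_. c) v = c"
  using card_Gam_nonzero by (simp add: sphere_mean_def)

lemma sphere_mean_0: "v \<in> verts X \<Longrightarrow> sphere_mean X 0 f v = f v"
  using Gam_0[OF conn] by (simp add: sphere_mean_def)

context
  fixes v\<^sub>0 assumes v0: "v\<^sub>0 \<in> verts X"
begin

lemma radial_mean_at_0: "radial_mean X v\<^sub>0 j \<phi> 0 = \<phi> j"
proof -
  have "radial_mean X v\<^sub>0 j \<phi> 0 = sphere_mean X j (\<lambda>w. \<phi> (gdist X v\<^sub>0 w)) v\<^sub>0"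
    using v0 by (simp add: radial_mean_def sphere_mean_0)
  also have "\<dots> = sphere_mean X j (\<lambda>w. \<phi> j) v\<^sub>0"
    by (rule sphere_mean_cong) (simp add: Gam_def)
  finally show ?thesis using v0 by (simp add: sphere_mean_const)
qed

lemma radial_mean_0: "radial_mean X v\<^sub>0 0 \<phi> = \<phi>"
proof
  fix i
  have "radial_mean X v\<^sub>0 0 \<phi> i = sphere_mean X i (\<lambda>w. \<phi> i) v\<^sub>0"
    unfolding radial_mean_def
    by (rule sphere_mean_cong) (simp add: sphere_mean_0 Gam_def)
  then show "radial_mean X v\<^sub>0 0 \<phi> i = \<phi> i" using v0 by (simp add: sphere_mean_const)
qed

text \<open>The cardinality in the numerator of \<open>P\<close> is the sum over
  \<open>Gam X j v\<close> of the indicator of distance \<open>k\<close> from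
  \<open>v\<^sub>0\<close>. Hence the structure constants are the matrix entries of
  \<open>T\<^sub>j\<close>.\<close>

lemma P_eq_radial_mean: "P X v\<^sub>0 i j k = radial_mean X v\<^sub>0 j (\<lambda>l. of_bool (l = k)) i"
proof -
  have "real (card (Gam X j v \<inter> Gam X k v\<^sub>0)) = (\<Sum>w\<in>Gam X j v. of_bool (gdist X v\<^sub>0 w = k))"
    if "v \<in> verts X" for v
  proof -
    have "Gam X j v \<inter> Gam X k v\<^sub>0 = Gam X j v \<inter> {w. gdist X v\<^sub>0 w = k}"
      by (auto simp: Gam_def)
    then show ?thesis
      using finite_Gam[OF conn loc_finite that] by simp
  qed
  then show ?thesis
    by (simp add: P_def radial_mean_def sphere_mean_def Gam_def)
qed

lemma P_nonneg: "P X v\<^sub>0 i j k \<ge> 0"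
  unfolding P_def by (intro mult_nonneg_nonneg sum_nonneg divide_nonneg_nonneg) auto

lemma radial_mean_eq_sum_P:
  assumes "i + j \<le> N"
  shows "radial_mean X v\<^sub>0 j \<phi> i = (\<Sum>k\<le>N. P X v\<^sub>0 i j k * \<phi> k)"
proof -
  have *: "\<phi> (gdist X v\<^sub>0 w) = (\<Sum>k\<le>N. \<phi> k * of_bool (gdist X v\<^sub>0 w = k))"
    if "v \<in> Gam X i v\<^sub>0" "w \<in> Gam X j v" for v w
  proof -
    have "gdist X v\<^sub>0 w \<le> N"
      using gdist_triangle[OF conn v0, of v w] that assms by (auto simp: Gam_def)
    then show ?thesis by (simp add: of_bool_def if_distrib sum.delta' cong: if_cong)
  qed
  have "radial_mean X v\<^sub>0 j \<phi> i =
      sphere_mean X i (sphere_mean X j (\<lambda>w. \<Sum>k\<le>N. \<phi> k * of_bool (gdist X v\<^sub>0 w = k))) v\<^sub>0"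
    unfolding radial_mean_def by (intro sphere_mean_cong) (rule *)
  also have "\<dots> = (\<Sum>k\<le>N. \<phi> k * P X v\<^sub>0 i j k)"
    by (simp only: sphere_mean_sum sphere_mean_cmult P_eq_radial_mean radial_mean_def)
  finally show ?thesis by (simp add: mult.commute)
qed

lemma P_eq_0:
  assumes "i + j < k"
  shows "P X v\<^sub>0 i j k = 0"
  using radial_mean_eq_sum_P[of i j "i + j" "\<lambda>l. of_bool (l = k)"] assms
  by (auto simp: P_eq_radial_mean intro!: sum.neutral)

text \<open>\<open>T\<^sub>j\<close> fixes the constant function 1. This becomes the norm
  axiom.\<close>

lemma sum_P: "i + j \<le> N \<Longrightarrow> (\<Sum>k\<le>N. P X v\<^sub>0 i j k) = 1"
  using radial_mean_eq_sum_P[of i j N "\<lambda>_. 1"] v0 sphere_mean_cong[of X i v\<^sub>0 "sphere_mean X j (\<lambda>_. 1)" "\<lambda>_. 1"]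
  by (simp add: radial_mean_def sphere_mean_const Gam_def)

lemma P_0_left: "P X v\<^sub>0 0 j k = of_bool (j = k)"
  by (simp add: P_eq_radial_mean radial_mean_at_0)

text \<open>By symmetry of the distance, \<open>v\<^sub>0\<close> lies on the sphere of radius
  \<open>j\<close> around a point at distance \<open>i\<close> exactly when \<open>i = j\<close>.
  This becomes the axiom on supports containing the neutral element.\<close>

lemma P_to_0: "P X v\<^sub>0 i j 0 \<noteq> 0 \<longleftrightarrow> i = j"
proof (cases "i = j")
  case True
  have "0 < real (card (Gam X j v \<inter> Gam X 0 v\<^sub>0)) / real (card (Gam X j v))"
    if "v \<in> Gam X i v\<^sub>0" for v
  proof -
    have "v \<in> verts X" "v\<^sub>0 \<in> Gam X j v"
      using that True v0 gdist_sym[OF conn v0, of v] by (auto simp: Gam_def)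
    then show ?thesis
      using card_Gam_pos[of v j] Gam_0[OF conn v0] by simp
  qed
  then have "P X v\<^sub>0 i j 0 > 0"
    unfolding P_def using v0 card_Gam_pos[OF v0, of i] Gam_nonempty[OF v0, of i]
    by (intro mult_pos_pos sum_pos) (auto simp: finite_Gam[OF conn loc_finite])
  with True show ?thesis by simp
next
  case False
  have "Gam X j v \<inter> Gam X 0 v\<^sub>0 = {}" if "v \<in> Gam X i v\<^sub>0" for v
    using that False Gam_0[OF conn v0] gdist_sym[OF conn v0, of v] by (auto simp: Gam_def)
  with False show ?thesis by (simp add: P_def)
qed

end

end

section \<open>Commuting radial means give a hypergroup\<close>

locale commuting_spherical_graph = spherical_graph X for X :: "'v ugraph" +
  assumes radial_mean_commute: "v\<^sub>0 \<in> verts X \<Longrightarrow>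
    radial_mean X v\<^sub>0 j (radial_mean X v\<^sub>0 k \<phi>) = radial_mean X v\<^sub>0 k (radial_mean X v\<^sub>0 j \<phi>)"
begin

context
  fixes v\<^sub>0 assumes v0: "v\<^sub>0 \<in> verts X"
begin

text \<open>Apply \<open>T\<^sub>i\<close> and \<open>T\<^sub>j\<close> in both orders to an
  indicator and evaluate at radius 0, where the outer operator becomes evaluation at its own
  index.\<close>

lemma P_commute: "P X v\<^sub>0 i j k = P X v\<^sub>0 j i k"
  using fun_cong[OF radial_mean_commute[OF v0], of i j "\<lambda>l. of_bool (l = k)" 0]
  by (simp add: radial_mean_at_0 P_eq_radial_mean v0)

text \<open>Write \<open>T\<^sub>j\<close> for \<open>radial_mean X v\<^sub>0 j\<close> and \<open>\<delta>\<close> for the indicator of \<open>m\<close>. Both sides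
  equal \<open>T\<^sub>j (T\<^sub>k \<delta>) i = T\<^sub>i (T\<^sub>j (T\<^sub>k \<delta>)) 0 = T\<^sub>j (T\<^sub>k (T\<^sub>i \<delta>)) 0\<close>.\<close>

lemma P_assoc:
  assumes "i + j \<le> N" "j + k \<le> N"
  shows "(\<Sum>l\<le>N. P X v\<^sub>0 i j l * P X v\<^sub>0 l k m) = (\<Sum>l\<le>N. P X v\<^sub>0 j k l * P X v\<^sub>0 i l m)"
proof -
  define T where "T = radial_mean X v\<^sub>0"
  define \<delta> :: "nat \<Rightarrow> real" where "\<delta> = (\<lambda>l. of_bool (l = m))"
  have P_T: "P X v\<^sub>0 i j m = T j \<delta> i" for i j
    using P_eq_radial_mean[OF v0] by (simp add: T_def \<delta>_def)
  have T_0: "T j \<phi> 0 = \<phi> j" for j \<phi>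
    using radial_mean_at_0[OF v0] by (simp add: T_def)
  have comm: "T j (T k \<phi>) = T k (T j \<phi>)" for j k \<phi>
    using radial_mean_commute[OF v0] by (simp add: T_def)
  have "(\<Sum>l\<le>N. P X v\<^sub>0 i j l * P X v\<^sub>0 l k m) = T j (T k \<delta>) i"
    unfolding P_T unfolding T_def by (rule radial_mean_eq_sum_P[OF v0 assms(1), symmetric])
  also have "\<dots> = T i (T j (T k \<delta>)) 0"
    by (simp add: T_0)
  also have "\<dots> = T j (T k (T i \<delta>)) 0"
    by (simp only: comm[of i])
  also have "\<dots> = T k (T i \<delta>) j"
    by (simp add: T_0)
  also have "\<dots> = (\<Sum>l\<le>N. P X v\<^sub>0 j k l * P X v\<^sub>0 l i m)"
    unfolding P_T unfolding T_def by (rule radial_mean_eq_sum_P[OF v0 assms(2)])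
  finally show ?thesis by (simp only: P_commute[of i])
qed

end

end

section \<open>The convolution in coordinates\<close>

lemma lookup_scale: "Poly_Mapping.lookup (scale c \<mu>) x = c * Poly_Mapping.lookup \<mu> x"
  by (simp add: scale_def Poly_Mapping.map.rep_eq when_def)

lemma lookup_rw_star: "Poly_Mapping.lookup (rw_star \<mu>) x = cnj (Poly_Mapping.lookup \<mu> x)"
  by (simp add: rw_star_def Poly_Mapping.map.rep_eq when_def)

lemma free_vs_iff: "\<mu> \<in> free_vs K \<longleftrightarrow> (\<forall>x. x \<notin> K \<longrightarrow> Poly_Mapping.lookup \<mu> x = 0)"
  by (auto simp: free_vs_def in_keys_iff)

context spherical_graph
begin

abbreviation coef :: "(('v \<times> 'v) set \<Rightarrow>\<^sub>0 complex) \<Rightarrow> nat \<Rightarrow> complex" where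
  "coef \<mu> i \<equiv> Poly_Mapping.lookup \<mu> (Rel X i)"

lemma free_vs_Rels_eqI:
  assumes "\<mu> \<in> free_vs (Rels X)" "\<nu> \<in> free_vs (Rels X)" "\<And>m. coef \<mu> m = coef \<nu> m"
  shows "\<mu> = \<nu>"
proof (rule poly_mapping_eqI)
  fix x show "Poly_Mapping.lookup \<mu> x = Poly_Mapping.lookup \<nu> x"
    using assms by (cases "x \<in> Rels X") (auto simp: free_vs_iff Rels_eq)
qed

lemma coef_bound: "\<exists>N. \<forall>i>N. coef \<mu> i = 0"
proof -
  have "finite (Rel X -` Poly_Mapping.keys \<mu>)"
    by (intro finite_vimageI) (auto simp: inj_def Rel_inject)
  then obtain N where "\<forall>i\<in>Rel X -` Poly_Mapping.keys \<mu>. i \<le> N"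
    using finite_nat_set_iff_bounded_le by auto
  then show ?thesis by (intro exI[of _ N]) (force simp: in_keys_iff)
qed

lemma coef_common_bound:
  obtains N where "\<And>i. i > N \<Longrightarrow> coef \<mu> i = 0" "\<And>i. i > N \<Longrightarrow> coef \<nu> i = 0"
    "\<And>i. i > N \<Longrightarrow> coef \<rho> i = 0"
proof -
  obtain A B C where "\<forall>i>A. coef \<mu> i = 0" "\<forall>i>B. coef \<nu> i = 0" "\<forall>i>C. coef \<rho> i = 0"
    using coef_bound by metis
  then show ?thesis using that[of "max A (max B C)"] by simp
qed

lemma coef_basis: "coef (basis (Rel X i)) j = of_bool (i = j)"
  by (simp add: basis_def lookup_single when_def Rel_inject)

context
  fixes v\<^sub>0 assumes v0: "v\<^sub>0 \<in> verts X"
begin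

text \<open>Finiteness of the index set matters, since a sum over an infinite set is 0 by default;
  it holds because \<open>P\<close> vanishes beyond \<open>i + j\<close>.\<close>

lemma coef_product:
  "coef (\<Sum>k\<in>{k \<in> indices X. P X v\<^sub>0 i j k \<noteq> 0}.
     scale (complex_of_real (P X v\<^sub>0 i j k)) (basis (Rel X k))) m = P X v\<^sub>0 i j m"
proof -
  have "{k. P X v\<^sub>0 i j k \<noteq> 0} \<subseteq> {..i + j}"
  proof
    fix k assume "k \<in> {k. P X v\<^sub>0 i j k \<noteq> 0}"
    then show "k \<in> {..i + j}" using P_eq_0[OF v0, of i j k] by (cases "i + j < k") auto
  qed
  then have fin: "finite {k. P X v\<^sub>0 i j k \<noteq> 0}"
    by (rule finite_subset) simp
  have "coef (\<Sum>k\<in>{k \<in> indices X. P X v\<^sub>0 i j k \<noteq> 0}.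
      scale (complex_of_real (P X v\<^sub>0 i j k)) (basis (Rel X k))) m =
      (\<Sum>k | P X v\<^sub>0 i j k \<noteq> 0. if k = m then complex_of_real (P X v\<^sub>0 i j m) else 0)"
    unfolding lookup_sum lookup_scale coef_basis indices_UNIV by (intro sum.cong) auto
  also have "\<dots> = P X v\<^sub>0 i j m"
    using fin by (simp add: sum.delta)
  finally show ?thesis .
qed

lemma rw_conv_closed: "rw_conv X v\<^sub>0 \<mu> \<nu> \<in> free_vs (Rels X)"
  unfolding free_vs_iff rw_conv_def lookup_sum lookup_scale
  by (intro allI impI sum.neutral ballI)
    (auto simp: basis_def lookup_single when_def Rels_eq intro!: sum.neutral)

text \<open>The sums over supports are enlarged to a rectangle, where they are easier to rearrange;
  the added terms have a zero coefficient. Two separate bounds are used because a product may be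
  supported on a longer range than its factors.\<close>

lemma coef_rw_conv:
  assumes "\<And>i. i > M \<Longrightarrow> coef \<mu> i = 0" "\<And>j. j > N \<Longrightarrow> coef \<nu> j = 0"
  shows "coef (rw_conv X v\<^sub>0 \<mu> \<nu>) m = (\<Sum>i\<le>M. \<Sum>j\<le>N. coef \<mu> i * coef \<nu> j * P X v\<^sub>0 i j m)"
proof -
  define R where "R i j = (\<Sum>k\<in>{k \<in> indices X. P X v\<^sub>0 i j k \<noteq> 0}.
    scale (complex_of_real (P X v\<^sub>0 i j k)) (basis (Rel X k)))" for i j
  have R: "coef (R i j) m = P X v\<^sub>0 i j m" for i j
    unfolding R_def by (rule coef_product)
  have "coef (rw_conv X v\<^sub>0 \<mu> \<nu>) m =
      (\<Sum>i | Rel X i \<in> Poly_Mapping.keys \<mu>. \<Sum>j | Rel X j \<in> Poly_Mapping.keys \<nu>.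
         coef \<mu> i * coef \<nu> j * P X v\<^sub>0 i j m)"
    unfolding rw_conv_def R_def[symmetric] by (simp only: lookup_sum lookup_scale R indices_UNIV UNIV_I simp_thms)
  also have "\<dots> = (\<Sum>i | Rel X i \<in> Poly_Mapping.keys \<mu>. \<Sum>j\<le>N. coef \<mu> i * coef \<nu> j * P X v\<^sub>0 i j m)"
  proof (rule sum.cong[OF refl], rule sum.mono_neutral_left)
    show "{j. Rel X j \<in> Poly_Mapping.keys \<nu>} \<subseteq> {..N}"
      using assms(2) by (auto simp: in_keys_iff simp flip: linorder_not_less)
  qed (auto simp: in_keys_iff)
  also have "\<dots> = (\<Sum>i\<le>M. \<Sum>j\<le>N. coef \<mu> i * coef \<nu> j * P X v\<^sub>0 i j m)"
  proof (rule sum.mono_neutral_left)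
    show "{i. Rel X i \<in> Poly_Mapping.keys \<mu>} \<subseteq> {..M}"
      using assms(1) by (auto simp: in_keys_iff simp flip: linorder_not_less)
  qed (auto simp: in_keys_iff)
  finally show ?thesis .
qed

lemma coef_rw_conv_bound:
  assumes "\<And>i. i > M \<Longrightarrow> coef \<mu> i = 0" "\<And>j. j > N \<Longrightarrow> coef \<nu> j = 0" "m > M + N"
  shows "coef (rw_conv X v\<^sub>0 \<mu> \<nu>) m = 0"
proof (subst coef_rw_conv[of M _ N])
  show "(\<Sum>i\<le>M. \<Sum>j\<le>N. coef \<mu> i * coef \<nu> j * P X v\<^sub>0 i j m) = 0"
    using assms(3) by (intro sum.neutral ballI) (simp add: P_eq_0[OF v0])
qed (use assms in auto)

lemma coef_conv_basis:
  "coef (rw_conv X v\<^sub>0 (basis (Rel X i)) (basis (Rel X j))) m = P X v\<^sub>0 i j m"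
proof (subst coef_rw_conv[of i _ j])
  show "(\<Sum>i'\<le>i. \<Sum>j'\<le>j. coef (basis (Rel X i)) i' * coef (basis (Rel X j)) j' * P X v\<^sub>0 i' j' m) =
      complex_of_real (P X v\<^sub>0 i j m)"
    by (simp add: coef_basis mult.assoc flip: sum_distrib_left)
qed (simp_all add: coef_basis)

text \<open>The coefficients are nonnegative reals, so the norm is the sum of the
  \<open>P X v\<^sub>0 i j k\<close> over \<open>k\<close>; injectivity of \<open>Rel X\<close>
  permits the reindexing.\<close>

lemma norm1_conv_basis: "norm1 (rw_conv X v\<^sub>0 (basis (Rel X i)) (basis (Rel X j))) = 1"
proof -
  define \<mu> where "\<mu> = rw_conv X v\<^sub>0 (basis (Rel X i)) (basis (Rel X j))"
  have coef: "coef \<mu> k = P X v\<^sub>0 i j k" for k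
    using coef_conv_basis by (simp add: \<mu>_def)
  have "Poly_Mapping.keys \<mu> \<subseteq> Rel X ` {..i + j}"
  proof
    fix x assume x: "x \<in> Poly_Mapping.keys \<mu>"
    then have "x \<in> Rels X" using rw_conv_closed by (auto simp: \<mu>_def free_vs_def)
    then obtain k where k: "x = Rel X k" by (auto simp: Rels_eq)
    then have "P X v\<^sub>0 i j k \<noteq> 0" using x coef by (simp add: in_keys_iff)
    then show "x \<in> Rel X ` {..i + j}" using k P_eq_0[OF v0, of i j k] by force
  qed
  then have "norm1 \<mu> = (\<Sum>x\<in>Rel X ` {..i + j}. cmod (Poly_Mapping.lookup \<mu> x))"
    unfolding norm1_def by (intro sum.mono_neutral_left) (auto simp: in_keys_iff)
  also have "\<dots> = (\<Sum>k\<le>i + j. P X v\<^sub>0 i j k)"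
    by (subst sum.reindex) (auto simp: inj_on_def Rel_inject coef P_nonneg[OF v0])
  finally show ?thesis using sum_P[OF v0] by (simp add: \<mu>_def)
qed

end

end

lemma sum_rotate:
  "(\<Sum>i\<in>A. \<Sum>j\<in>B. \<Sum>k\<in>C. f i j k) = (\<Sum>k\<in>C. \<Sum>i\<in>A. \<Sum>j\<in>B. f i j k)"
proof -
  have "(\<Sum>i\<in>A. \<Sum>j\<in>B. \<Sum>k\<in>C. f i j k) = (\<Sum>i\<in>A. \<Sum>k\<in>C. \<Sum>j\<in>B. f i j k)"
    by (rule sum.cong[OF refl], rule sum.swap)
  then show ?thesis by (simp only: sum.swap[of _ C A])
qed

text \<open>Both sides expand into fourfold sums. Once the sum over the intermediate index
  \<open>l\<close> is moved innermost, they agree term by term in \<open>i\<close>,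
  \<open>j\<close>, \<open>k\<close> by \<open>P_assoc\<close>.\<close>

lemma (in commuting_spherical_graph) coef_rw_conv_assoc:
  assumes v0: "v\<^sub>0 \<in> verts X"
  shows "coef (rw_conv X v\<^sub>0 (rw_conv X v\<^sub>0 \<mu> \<nu>) \<rho>) m = coef (rw_conv X v\<^sub>0 \<mu> (rw_conv X v\<^sub>0 \<nu> \<rho>)) m"
proof -
  obtain N where N: "\<And>i. i > N \<Longrightarrow> coef \<mu> i = 0" "\<And>i. i > N \<Longrightarrow> coef \<nu> i = 0"
    "\<And>i. i > N \<Longrightarrow> coef \<rho> i = 0"
    using coef_common_bound[of \<mu> \<nu> \<rho>] by blast
  note conv = coef_rw_conv[OF v0, of _ _ N]
  have bound: "coef (rw_conv X v\<^sub>0 \<mu> \<nu>) i = 0" "coef (rw_conv X v\<^sub>0 \<nu> \<rho>) i = 0" if "i > N + N" for i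
    by (rule coef_rw_conv_bound[OF v0, of N _ N]; use that N in blast)+
  have "coef (rw_conv X v\<^sub>0 (rw_conv X v\<^sub>0 \<mu> \<nu>) \<rho>) m =
      (\<Sum>l\<le>N+N. \<Sum>k\<le>N. (\<Sum>i\<le>N. \<Sum>j\<le>N. coef \<mu> i * coef \<nu> j * P X v\<^sub>0 i j l) * coef \<rho> k * P X v\<^sub>0 l k m)"
    by (simp only: conv[OF bound(1) N(3)] conv[OF N(1) N(2)])
  also have "\<dots> = (\<Sum>l\<le>N+N. \<Sum>k\<le>N. \<Sum>i\<le>N. \<Sum>j\<le>N.
      coef \<mu> i * coef \<nu> j * coef \<rho> k * of_real (P X v\<^sub>0 i j l * P X v\<^sub>0 l k m))"
    by (simp add: sum_distrib_right sum_distrib_left mult_ac)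
  also have "\<dots> = (\<Sum>i\<le>N. \<Sum>j\<le>N. \<Sum>k\<le>N. \<Sum>l\<le>N+N.
      coef \<mu> i * coef \<nu> j * coef \<rho> k * of_real (P X v\<^sub>0 i j l * P X v\<^sub>0 l k m))"
    by (subst sum_rotate, rule sum.cong[OF refl], subst sum_rotate, rule sum.cong[OF refl], rule sum.swap)
  also have "\<dots> = (\<Sum>i\<le>N. \<Sum>j\<le>N. \<Sum>k\<le>N.
      coef \<mu> i * coef \<nu> j * coef \<rho> k * of_real (\<Sum>l\<le>N+N. P X v\<^sub>0 i j l * P X v\<^sub>0 l k m))"
    by (simp add: sum_distrib_left)
  \<comment> \<open>As \<open>i\<close>, \<open>j\<close>, \<open>k\<close> are at most
    \<open>N\<close>, the bound \<open>N + N\<close> meets both premises of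
    \<open>P_assoc\<close>.\<close>
  also have "\<dots> = (\<Sum>i\<le>N. \<Sum>j\<le>N. \<Sum>k\<le>N.
      coef \<mu> i * coef \<nu> j * coef \<rho> k * of_real (\<Sum>l\<le>N+N. P X v\<^sub>0 j k l * P X v\<^sub>0 i l m))"
    by (rule sum.cong[OF refl])+ (simp add: P_assoc[OF v0])
  also have "\<dots> = (\<Sum>i\<le>N. \<Sum>j\<le>N. \<Sum>k\<le>N. \<Sum>l\<le>N+N.
      coef \<mu> i * coef \<nu> j * coef \<rho> k * of_real (P X v\<^sub>0 j k l * P X v\<^sub>0 i l m))"
    by (simp add: sum_distrib_left)
  also have "\<dots> = (\<Sum>i\<le>N. \<Sum>l\<le>N+N. \<Sum>j\<le>N. \<Sum>k\<le>N.
      coef \<mu> i * coef \<nu> j * coef \<rho> k * of_real (P X v\<^sub>0 j k l * P X v\<^sub>0 i l m))"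
    by (rule sum.cong[OF refl], rule sum_rotate)
  also have "\<dots> = (\<Sum>i\<le>N. \<Sum>l\<le>N+N.
      coef \<mu> i * (\<Sum>j\<le>N. \<Sum>k\<le>N. coef \<nu> j * coef \<rho> k * P X v\<^sub>0 j k l) * P X v\<^sub>0 i l m)"
    by (simp add: sum_distrib_right sum_distrib_left mult_ac)
  also have "\<dots> = coef (rw_conv X v\<^sub>0 \<mu> (rw_conv X v\<^sub>0 \<nu> \<rho>)) m"
    by (simp only: coef_rw_conv[OF v0 N(1) bound(2)] conv[OF N(2) N(3)])
  finally show ?thesis .
qed

text \<open>Besides being inherited from \<open>P_commute\<close>, this transfers each law in the
  left argument to the right one.\<close>

lemma (in commuting_spherical_graph) rw_conv_commute:
  assumes v0: "v\<^sub>0 \<in> verts X"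
  shows "rw_conv X v\<^sub>0 \<mu> \<nu> = rw_conv X v\<^sub>0 \<nu> \<mu>"
proof (rule free_vs_Rels_eqI)
  fix m
  obtain N where N: "\<And>i. i > N \<Longrightarrow> coef \<mu> i = 0" "\<And>i. i > N \<Longrightarrow> coef \<nu> i = 0"
    using coef_common_bound by metis
  have "coef (rw_conv X v\<^sub>0 \<mu> \<nu>) m = (\<Sum>i\<le>N. \<Sum>j\<le>N. coef \<mu> i * coef \<nu> j * P X v\<^sub>0 i j m)"
    by (rule coef_rw_conv[OF v0 N])
  also have "\<dots> = (\<Sum>j\<le>N. \<Sum>i\<le>N. coef \<mu> i * coef \<nu> j * P X v\<^sub>0 i j m)"
    by (rule sum.swap)
  also have "\<dots> = (\<Sum>j\<le>N. \<Sum>i\<le>N. coef \<nu> j * coef \<mu> i * P X v\<^sub>0 j i m)"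
    by (simp only: P_commute[OF v0] mult.commute)
  also have "\<dots> = coef (rw_conv X v\<^sub>0 \<nu> \<mu>) m"
    by (rule coef_rw_conv[OF v0 N(2) N(1), symmetric])
  finally show "coef (rw_conv X v\<^sub>0 \<mu> \<nu>) m = coef (rw_conv X v\<^sub>0 \<nu> \<mu>) m" .
qed (rule rw_conv_closed[OF v0])+

text \<open>Most algebraic laws are compared coefficient by coefficient, with one bound
  \<open>N\<close> for all vectors involved; the axioms on basis elements are properties of
  \<open>P\<close>. The neutral element is the diagonal relation \<open>Rel X 0\<close>.\<close>

theorem (in commuting_spherical_graph) hypergroup: "random_walk_produces_hypergroup X"
proof -
  have "discrete_hypergroup (Rels X) (rw_conv X v\<^sub>0) rw_star (Rel X 0)" if v0: "v\<^sub>0 \<in> verts X" for v\<^sub>0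
  proof
    fix \<mu> \<nu> \<rho> :: "('v \<times> 'v) set \<Rightarrow>\<^sub>0 complex" and c
    assume \<mu>: "\<mu> \<in> free_vs (Rels X)"
    obtain N where N: "\<And>i. i > N \<Longrightarrow> coef \<mu> i = 0" "\<And>i. i > N \<Longrightarrow> coef \<nu> i = 0"
      "\<And>i. i > N \<Longrightarrow> coef \<rho> i = 0"
      using coef_common_bound[of \<mu> \<nu> \<rho>] by blast
    note conv = coef_rw_conv[OF v0, of N _ N] and closed = rw_conv_closed[OF v0]
    have basis0: "coef (basis (Rel X 0)) i = 0" if "i > N" for i
      using that by (simp add: coef_basis)
    show "rw_star \<mu> \<in> free_vs (Rels X)"
      using \<mu> by (simp add: free_vs_iff lookup_rw_star)
    show "rw_star (rw_star \<mu>) = \<mu>"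
      by (rule poly_mapping_eqI) (simp add: lookup_rw_star)
    show "rw_star (scale c \<mu>) = scale (cnj c) (rw_star \<mu>)"
      by (rule poly_mapping_eqI) (simp add: lookup_rw_star lookup_scale)
    show left: "rw_conv X v\<^sub>0 (basis (Rel X 0)) \<mu> = \<mu>"
    proof (rule free_vs_Rels_eqI[OF closed \<mu>])
      fix m
      have "coef (rw_conv X v\<^sub>0 (basis (Rel X 0)) \<mu>) m = (\<Sum>j\<le>N. if j = m then coef \<mu> j else 0)"
      proof (subst coef_rw_conv[OF v0, of 0 _ N])
        show "(\<Sum>i\<le>0. \<Sum>j\<le>N. coef (basis (Rel X 0)) i * coef \<mu> j * P X v\<^sub>0 i j m) =
            (\<Sum>j\<le>N. if j = m then coef \<mu> j else 0)"
        proof -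
          have "coef \<mu> j * complex_of_real (of_bool (j = m)) = (if j = m then coef \<mu> j else 0)" for j
            by simp
          then show ?thesis by (simp add: coef_basis P_0_left[OF v0])
        qed
      qed (simp_all add: coef_basis N)
      also have "\<dots> = coef \<mu> m"
        using N(1)[of m] by auto
      finally show "coef (rw_conv X v\<^sub>0 (basis (Rel X 0)) \<mu>) m = coef \<mu> m" .
    qed
    then show "rw_conv X v\<^sub>0 \<mu> (basis (Rel X 0)) = \<mu>"
      by (simp only: rw_conv_commute[OF v0])
    assume \<nu>: "\<nu> \<in> free_vs (Rels X)"
    show "rw_conv X v\<^sub>0 \<mu> \<nu> \<in> free_vs (Rels X)" by (rule closed)
    show "rw_star (\<mu> + \<nu>) = rw_star \<mu> + rw_star \<nu>"
      by (rule poly_mapping_eqI) (simp add: lookup_rw_star lookup_add)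
    \<comment> \<open>Stated for arbitrary vectors, because linearity in the right argument uses it
      with the two factors exchanged.\<close>
    have scale_left: "rw_conv X v\<^sub>0 (scale c \<mu>) \<nu> = scale c (rw_conv X v\<^sub>0 \<mu> \<nu>)"
      if "\<And>i. i > N \<Longrightarrow> coef \<mu> i = 0" "\<And>i. i > N \<Longrightarrow> coef \<nu> i = 0" for \<mu> \<nu>
    proof (rule free_vs_Rels_eqI[OF closed])
      show "scale c (rw_conv X v\<^sub>0 \<mu> \<nu>) \<in> free_vs (Rels X)"
        using closed[of \<mu> \<nu>] by (simp add: free_vs_iff lookup_scale)
    qed (simp add: conv lookup_scale that sum_distrib_left mult_ac)
    show "rw_conv X v\<^sub>0 (scale c \<mu>) \<nu> = scale c (rw_conv X v\<^sub>0 \<mu> \<nu>)"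
      by (rule scale_left) (rule N; assumption)+
    show "rw_conv X v\<^sub>0 \<mu> (scale c \<nu>) = scale c (rw_conv X v\<^sub>0 \<mu> \<nu>)"
      unfolding rw_conv_commute[OF v0, of \<mu>] by (rule scale_left) (rule N; assumption)+
    \<comment> \<open>The structure constants are real, so conjugation is multiplicative;
      commutativity absorbs the reversal of the factors.\<close>
    show "rw_star (rw_conv X v\<^sub>0 \<mu> \<nu>) = rw_conv X v\<^sub>0 (rw_star \<nu>) (rw_star \<mu>)"
      unfolding rw_conv_commute[OF v0, of "rw_star \<nu>"]
    proof (rule free_vs_Rels_eqI[OF _ closed])
      show "rw_star (rw_conv X v\<^sub>0 \<mu> \<nu>) \<in> free_vs (Rels X)"
        using closed[of \<mu> \<nu>] by (simp add: free_vs_iff lookup_rw_star)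
    qed (simp add: conv lookup_rw_star N)
    assume \<rho>: "\<rho> \<in> free_vs (Rels X)"
    have add_left: "rw_conv X v\<^sub>0 (\<mu> + \<nu>) \<rho> = rw_conv X v\<^sub>0 \<mu> \<rho> + rw_conv X v\<^sub>0 \<nu> \<rho>"
      if "\<And>i. i > N \<Longrightarrow> coef \<mu> i = 0" "\<And>i. i > N \<Longrightarrow> coef \<nu> i = 0"
        "\<And>i. i > N \<Longrightarrow> coef \<rho> i = 0" for \<mu> \<nu> \<rho>
    proof (rule free_vs_Rels_eqI[OF closed])
      show "rw_conv X v\<^sub>0 \<mu> \<rho> + rw_conv X v\<^sub>0 \<nu> \<rho> \<in> free_vs (Rels X)"
        using closed[of \<mu> \<rho>] closed[of \<nu> \<rho>] by (simp add: free_vs_iff lookup_add)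
    qed (simp add: conv lookup_add that sum.distrib algebra_simps)
    show "rw_conv X v\<^sub>0 (\<mu> + \<nu>) \<rho> = rw_conv X v\<^sub>0 \<mu> \<rho> + rw_conv X v\<^sub>0 \<nu> \<rho>"
      by (rule add_left) (rule N; assumption)+
    show "rw_conv X v\<^sub>0 \<mu> (\<nu> + \<rho>) = rw_conv X v\<^sub>0 \<mu> \<nu> + rw_conv X v\<^sub>0 \<mu> \<rho>"
      unfolding rw_conv_commute[OF v0, of \<mu>] by (rule add_left) (rule N; assumption)+
    show "rw_conv X v\<^sub>0 (rw_conv X v\<^sub>0 \<mu> \<nu>) \<rho> = rw_conv X v\<^sub>0 \<mu> (rw_conv X v\<^sub>0 \<nu> \<rho>)"
      by (rule free_vs_Rels_eqI[OF closed closed]) (rule coef_rw_conv_assoc[OF v0])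
  next
    have star_basis: "rw_star (basis x) = basis x" for x :: "('v \<times> 'v) set"
      by (rule poly_mapping_eqI) (simp add: lookup_rw_star basis_def lookup_single when_def)
    then show "rw_star ` basis ` Rels X = basis ` Rels X"
      by (simp add: image_image)
    show "Rel X 0 \<in> Rels X" by (simp add: Rels_eq)
    fix x y assume "x \<in> Rels X" "y \<in> Rels X"
    then obtain i j where ij: "x = Rel X i" "y = Rel X j" by (auto simp: Rels_eq)
    show "norm1 (rw_conv X v\<^sub>0 (basis x) (basis y)) = 1"
      using norm1_conv_basis[OF v0] ij by simp
    \<comment> \<open>Since \<open>rw_star\<close> fixes basis vectors, the support axiom reduces to
      \<open>i = j\<close>.\<close>
    have "basis y = basis x \<longleftrightarrow> i = j"
    proof
      assume "basis y = basis x"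
      then have "coef (basis (Rel X j)) j = coef (basis (Rel X i)) j" using ij by simp
      then show "i = j" by (simp add: coef_basis split: if_splits)
    qed (use ij in simp)
    then show "Rel X 0 \<in> Poly_Mapping.keys (rw_conv X v\<^sub>0 (basis x) (basis y)) \<longleftrightarrow>
        basis y = rw_star (basis x)"
      using P_to_0[OF v0, of i j] by (simp add: in_keys_iff ij coef_conv_basis[OF v0] star_basis)
    fix z assume "z \<in> Rels X"
    then obtain k where "z = Rel X k" by (auto simp: Rels_eq)
    then show "Poly_Mapping.lookup (rw_conv X v\<^sub>0 (basis x) (basis y)) z \<in> \<real>\<^sub>\<ge>\<^sub>0"
      using P_nonneg[OF v0] by (simp add: ij coef_conv_basis[OF v0])
  qed
  moreover have "P_well_defined X v\<^sub>0" if "v\<^sub>0 \<in> verts X" for v\<^sub>0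
    using that card_Gam_nonzero unfolding P_well_defined_def by (meson Gam_subset_verts subsetD)
  ultimately show ?thesis
    using simple conn loc_finite by (auto simp: random_walk_produces_hypergroup_def)
qed

section \<open>Commutation from a three-term recurrence\<close>

lemma commute_of_three_term_recurrence:
  fixes T :: "nat \<Rightarrow> (nat \<Rightarrow> real) \<Rightarrow> nat \<Rightarrow> real"
  assumes T_0: "\<And>\<phi>. T 0 \<phi> = \<phi>"
    and linear: "\<And>j a b \<phi> \<psi>. T j (\<lambda>i. a * \<phi> i + b * \<psi> i) = (\<lambda>i. a * T j \<phi> i + b * T j \<psi> i)"
    and rec: "\<And>j. \<exists>a b. \<forall>\<phi>. T (j + 2) \<phi> = (\<lambda>i. a * T 1 (T (j + 1) \<phi>) i + b * T j \<phi> i)"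
  shows "T j (T k \<phi>) = T k (T j \<phi>)"
proof -
  \<comment> \<open>The recurrence makes every \<open>T j\<close> a polynomial in
    \<open>T 1\<close>, so an operator \<open>T k\<close> commuting with \<open>T 1\<close> commutes
    with all of them.\<close>
  have *: "T k (T j \<phi>) = T j (T k \<phi>)" if T_1: "\<And>\<phi>. T k (T 1 \<phi>) = T 1 (T k \<phi>)" for j k \<phi>
  proof (induction j arbitrary: \<phi> rule: less_induct)
    case (less j)
    consider "j = 0" | "j = 1" | m where "j = m + 2"
      by (metis One_nat_def add_2_eq_Suc' not0_implies_Suc)
    then show ?case
    proof cases
      case 3
      obtain a b where ab: "\<And>\<phi>. T j \<phi> = (\<lambda>i. a * T 1 (T (m + 1) \<phi>) i + b * T m \<phi> i)"
        using rec[of m] 3 by blast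
      have "T k (T j \<phi>) = (\<lambda>i. a * T 1 (T k (T (m + 1) \<phi>)) i + b * T k (T m \<phi>) i)"
        unfolding ab linear T_1 ..
      also have "\<dots> = T j (T k \<phi>)"
        using less[of "m + 1"] less[of m] 3 unfolding ab by simp
      finally show ?thesis .
    qed (use T_0 T_1 in simp_all)
  qed
  \<comment> \<open>For \<open>k = 1\<close> the premise of \<open>*\<close> is trivial, so
    \<open>T 1\<close> commutes with every \<open>T j\<close>; this in turn is the premise of
    \<open>*\<close> for arbitrary \<open>k\<close>.\<close>
  show ?thesis using *[OF *[of 1, symmetric]] by simp
qed

lemma (in spherical_graph) hypergroup_of_three_term_recurrence:
  assumes "\<And>v\<^sub>0 j. v\<^sub>0 \<in> verts X \<Longrightarrow> \<exists>a b. \<forall>\<phi>. radial_mean X v\<^sub>0 (j + 2) \<phi> =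
    (\<lambda>i. a * radial_mean X v\<^sub>0 1 (radial_mean X v\<^sub>0 (j + 1) \<phi>) i + b * radial_mean X v\<^sub>0 j \<phi> i)"
  shows "random_walk_produces_hypergroup X"
proof -
  interpret commuting_spherical_graph X
    by unfold_locales (rule commute_of_three_term_recurrence[OF radial_mean_0 radial_mean_linear assms])
  show ?thesis by (rule hypergroup)
qed

section \<open>Regular trees\<close>

text \<open>When a prepended vertex already occurs on the path, the path is cut to start at that
  occurrence.\<close>

lemma rtranclp_distinct_path:
  assumes "r\<^sup>*\<^sup>* x y"
  obtains p where "p \<noteq> []" "distinct p" "successively r p" "hd p = x" "last p = y"
proof -
  have "\<exists>p. p \<noteq> [] \<and> distinct p \<and> successively r p \<and> hd p = x \<and> last p = y"
    using assms
  proof (induction rule: converse_rtranclp_induct)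
    case base
    show ?case by (rule exI[of _ "[y]"]) simp
  next
    case (step x z)
    then obtain p where p: "p \<noteq> []" "distinct p" "successively r p" "hd p = z" "last p = y"
      by blast
    show ?case
    proof (cases "x \<in> set p")
      case True
      then obtain a b where "p = a @ x # b" by (meson split_list)
      then show ?thesis
        using p by (intro exI[of _ "x # b"]) (auto simp: successively_append_iff)
    next
      case False
      then show ?thesis
        using p step by (intro exI[of _ "x # p"]) (auto simp: successively_Cons)
    qed
  qed
  then show ?thesis using that by blast
qed

lemma successively_subset:
  assumes "successively r p" "p \<noteq> []" "hd p \<in> A" "\<And>x y. r x y \<Longrightarrow> y \<in> A"
  shows "set p \<subseteq> A"
  using assms(1-3)
proof (induction p)
  case (Cons a p)
  then show ?case using assms(4)[of a "hd p"] by (cases "p = []") (auto simp: successively_Cons)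
qed simp

lemma acyclic_closer_neighbour_unique:
  assumes simple: "simple_graph X" and conn: "connected_graph X" and acyclic: "\<nexists>p. is_cycle X p"
    and verts: "v \<in> verts X" "w \<in> verts X"
    and nbrs: "u \<in> neighbours X v" "u' \<in> neighbours X v"
    and dist: "gdist X u w \<le> gdist X v w" "gdist X u' w \<le> gdist X v w"
  shows "u = u'"
proof (rule ccontr)
  assume "u \<noteq> u'"
  define r where "r x y \<longleftrightarrow> {x, y} \<in> edges X \<and> x \<in> verts X - {v} \<and> y \<in> verts X - {v}" for x y
  \<comment> \<open>Along a geodesic from \<open>x\<close> the distance to \<open>w\<close> drops
    below \<open>gdist X v w\<close> after the first step, so \<open>v\<close> is never met.\<close>
  have to_w: "r\<^sup>*\<^sup>* x w" if "x \<in> verts X" "x \<noteq> v" "gdist X x w = n" "n \<le> gdist X v w" for x n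
    using that
  proof (induction n arbitrary: x)
    case 0
    then show ?case using gdist_eq_0_iff[OF conn] verts by auto
  next
    case (Suc n)
    then obtain y where y: "y \<in> neighbours X x" "gdist X y w = n"
      using gdist_descent[OF conn _ verts(2)] by metis
    then have "y \<noteq> v" using Suc.prems by auto
    then have "r x y" using y Suc.prems by (auto simp: r_def neighbours_def)
    moreover have "r\<^sup>*\<^sup>* y w"
      using Suc y \<open>y \<noteq> v\<close> by (auto simp: neighbours_def)
    ultimately show ?case by (rule converse_rtranclp_into_rtranclp)
  qed
  have u: "u \<in> verts X" "u \<noteq> v" "{v, u} \<in> edges X" "u' \<in> verts X" "u' \<noteq> v" "{v, u'} \<in> edges X"
    using nbrs simple by (auto simp: neighbours_def simple_graph_def)
  have "symp r" by (auto simp: symp_def r_def insert_commute)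
  then have "r\<^sup>*\<^sup>* w u'"
    using to_w[OF u(4,5) refl dist(2)] by (meson symp_rtranclp sympD)
  then have "r\<^sup>*\<^sup>* u u'" using to_w[OF u(1,2) refl dist(1)] by simp
  then obtain p where p: "p \<noteq> []" "distinct p" "successively r p" "hd p = u" "last p = u'"
    by (rule rtranclp_distinct_path)
  have sub: "set p \<subseteq> verts X - {v}"
    using p u by (intro successively_subset[of r]) (auto simp: r_def)
  have "successively (\<lambda>x y. {x, y} \<in> edges X) p"
    using p(3) by (rule successively_mono) (auto simp: r_def)
  then have "walk X p" using p sub by (auto simp: walk_def)
  then have "walk X (v # p)"
    using p u verts by (simp add: walk_Cons)
  \<comment> \<open>The ends of \<open>p\<close> differ, so \<open>p\<close> has at least two
    vertices.\<close>
  moreover have "3 \<le> length (v # p)"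
    using p \<open>u \<noteq> u'\<close> by (cases p; cases "tl p") auto
  ultimately have "is_cycle X (v # p)"
    using p sub u by (auto simp: is_cycle_def insert_commute)
  with acyclic show False by blast
qed

section \<open>Sphere sizes and the recurrence for sphere means on the tree\<close>

locale regular_tree =
  fixes k :: nat and X :: "'v ugraph"
  assumes degree_ge_2: "k \<ge> 2" and tree: "infinite_regular_tree k X"
begin

lemma simple: "simple_graph X" and conn: "connected_graph X" and acyclic: "\<nexists>p. is_cycle X p"
  using tree by (auto simp: infinite_regular_tree_def)

lemma finite_neighbours: "v \<in> verts X \<Longrightarrow> finite (neighbours X v)"
  and card_neighbours: "v \<in> verts X \<Longrightarrow> card (neighbours X v) = k"
  using tree by (auto simp: infinite_regular_tree_def regular_graph_def)

lemma loc_finite: "locally_finite X"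
  using finite_neighbours by (simp add: locally_finite_def)

lemma Gam_1: "v \<in> verts X \<Longrightarrow> Gam X 1 v = neighbours X v"
  using neighbours_eq_Gam_1[OF simple conn] by simp

text \<open>If \<open>v\<close> differs from \<open>w\<close>, exactly one neighbour of
  \<open>v\<close> is closer to \<open>w\<close>, and the other \<open>k - 1\<close> are one step
  farther away.\<close>

lemma sum_neighbours_gdist:
  fixes g :: "nat \<Rightarrow> real"
  assumes v: "v \<in> verts X" and w: "w \<in> verts X"
  shows "(\<Sum>u\<in>neighbours X v. g (gdist X u w)) =
    (case gdist X v w of 0 \<Rightarrow> k * g 1 | Suc n \<Rightarrow> g n + (k - 1) * g (n + 2))"
proof (cases "gdist X v w")
  case 0
  then have "v = w" using gdist_eq_0_iff[OF conn v w] by simp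
  have "gdist X u w = 1" if "u \<in> neighbours X v" for u
  proof -
    have "u \<in> Gam X 1 v" using that Gam_1[OF v] by simp
    then show ?thesis using gdist_sym[OF conn v, of u] \<open>v = w\<close> by (simp add: Gam_def)
  qed
  then show ?thesis using 0 card_neighbours[OF v] by simp
next
  case (Suc n)
  then obtain u where u: "u \<in> neighbours X v" "gdist X u w = n"
    using gdist_descent[OF conn v w] by metis
  have far: "gdist X u' w = n + 2" if "u' \<in> neighbours X v - {u}" for u'
  proof -
    have "\<not> gdist X u' w \<le> gdist X v w"
      using acyclic_closer_neighbour_unique[OF simple conn acyclic v w, of u u'] u that Suc by auto
    then show ?thesis
      using gdist_neighbour(1)[OF conn v _ w, of u'] that Suc by auto
  qed
  have "(\<Sum>u\<in>neighbours X v. g (gdist X u w)) =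
      g n + (\<Sum>u'\<in>neighbours X v - {u}. g (gdist X u' w))"
    using u by (simp add: sum.remove[OF finite_neighbours[OF v]])
  also have "(\<Sum>u'\<in>neighbours X v - {u}. g (gdist X u' w)) = (k - 1) * g (n + 2)"
    using far u card_neighbours[OF v] finite_neighbours[OF v] by simp
  finally show ?thesis using Suc by simp
qed

text \<open>Double counting: a point \<open>w\<close> occurs on the left once for each neighbour
  \<open>u\<close> of \<open>v\<close> at distance \<open>m + 1\<close> from it. That is one
  neighbour if \<open>w\<close> is at distance \<open>m + 2\<close> from \<open>v\<close>, and
  \<open>k - 1\<close> of them, or all \<open>k\<close> when \<open>m = 0\<close>, if
  \<open>w\<close> is at distance \<open>m\<close>.\<close>

lemma sum_neighbours_sum_Gam:
  fixes f :: "'v \<Rightarrow> real"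
  assumes v: "v \<in> verts X"
  shows "(\<Sum>u\<in>neighbours X v. \<Sum>w\<in>Gam X (Suc m) u. f w) =
    (\<Sum>w\<in>Gam X (m + 2) v. f w) + (if m = 0 then k else k - 1) * (\<Sum>w\<in>Gam X m v. f w)"
proof -
  \<comment> \<open>The ball of radius \<open>m + 2\<close> around \<open>v\<close> is a common
    finite domain for all spheres involved, so the order of summation can be exchanged.\<close>
  define B where "B = (\<Union>i\<le>m + 2. Gam X i v)"
  define \<delta> :: "nat \<Rightarrow> nat \<Rightarrow> real" where "\<delta> i l = of_bool (l = i)" for i l
  have finB: "finite B" using finite_Gam[OF conn loc_finite v] by (simp add: B_def)
  have B: "B \<subseteq> verts X" using Gam_subset_verts by (fastforce simp: B_def)
  have restrict: "(\<Sum>w\<in>Gam X i u. f w) = (\<Sum>w\<in>B. f w * \<delta> i (gdist X u w))"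
    if "Gam X i u \<subseteq> B" for u i
  proof -
    have "Gam X i u = {w \<in> B. gdist X u w = i}"
      using that B by (auto simp: Gam_def)
    then show ?thesis
      using finB by (simp add: \<delta>_def sum.inter_filter of_bool_def if_distrib cong: if_cong)
  qed
  have near: "Gam X (Suc m) u \<subseteq> B" if "u \<in> neighbours X v" for u
  proof
    fix w assume "w \<in> Gam X (Suc m) u"
    then have w: "w \<in> verts X" "gdist X u w = Suc m" by (auto simp: Gam_def)
    then have "gdist X v w \<le> m + 2" using gdist_neighbour(2)[OF conn v that, of w] by simp
    then show "w \<in> B" using w by (auto simp: B_def Gam_def)
  qed
  have "(\<Sum>u\<in>neighbours X v. \<Sum>w\<in>Gam X (Suc m) u. f w) =
      (\<Sum>u\<in>neighbours X v. \<Sum>w\<in>B. f w * \<delta> (Suc m) (gdist X u w))"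
    using restrict near by simp
  also have "\<dots> = (\<Sum>w\<in>B. f w * (\<Sum>u\<in>neighbours X v. \<delta> (Suc m) (gdist X u w)))"
    unfolding sum_distrib_left by (rule sum.swap)
  also have "\<dots> = (\<Sum>w\<in>B. f w * (\<delta> (m + 2) (gdist X v w) +
      (if m = 0 then k else k - 1) * \<delta> m (gdist X v w)))"
  proof (intro sum.cong refl arg_cong2[where f = "(*)"])
    fix w assume "w \<in> B"
    then have w: "w \<in> verts X" using B by blast
    show "(\<Sum>u\<in>neighbours X v. \<delta> (Suc m) (gdist X u w)) =
        \<delta> (m + 2) (gdist X v w) + (if m = 0 then k else k - 1) * \<delta> m (gdist X v w)"
      unfolding sum_neighbours_gdist[OF v w] by (auto simp: \<delta>_def split: nat.split)
  qed
  also have "\<dots> = (\<Sum>w\<in>B. f w * \<delta> (m + 2) (gdist X v w)) +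
      (if m = 0 then k else k - 1) * (\<Sum>w\<in>B. f w * \<delta> m (gdist X v w))"
    by (simp add: sum.distrib sum_distrib_left algebra_simps)
  also have "\<dots> = (\<Sum>w\<in>Gam X (m + 2) v. f w) + (if m = 0 then k else k - 1) * (\<Sum>w\<in>Gam X m v. f w)"
  proof -
    have "Gam X i v \<subseteq> B" if "i \<le> m + 2" for i using that by (auto simp: B_def)
    then show ?thesis by (simp add: restrict)
  qed
  finally show ?thesis .
qed

text \<open>Double counting with the constant function 1 gives a two-step recurrence for the sphere
  sizes, hence the strong induction.\<close>

lemma card_Gam: "v \<in> verts X \<Longrightarrow> real (card (Gam X (Suc m) v)) = k * (real k - 1) ^ m"
proof (induction m arbitrary: v rule: less_induct)
  case (less m)
  have nb: "u \<in> verts X" if "u \<in> neighbours X v" for u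
    using that by (simp add: neighbours_def)
  show ?case
  proof (cases m)
    case 0
    then show ?thesis using Gam_1 card_neighbours less.prems by simp
  next
    case (Suc l)
    have "real k * (k * (real k - 1) ^ l) = (\<Sum>u\<in>neighbours X v. real (card (Gam X (Suc l) u)))"
      using less.IH[of l] nb Suc by (simp add: card_neighbours[OF less.prems])
    also have "\<dots> = real (card (Gam X (Suc m) v)) + (if l = 0 then k else k - 1) * card (Gam X l v)"
      using sum_neighbours_sum_Gam[OF less.prems, of "\<lambda>_. 1" l] Suc by simp
    finally have eq: "real k * (k * (real k - 1) ^ l) =
        real (card (Gam X (Suc m) v)) + (if l = 0 then k else k - 1) * card (Gam X l v)" .
    show ?thesis
    proof (cases l)
      case 0
      then show ?thesis
        using eq Suc Gam_0[OF conn less.prems] by (simp add: algebra_simps)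
    next
      case (Suc l')
      then have "real (card (Gam X l v)) = k * (real k - 1) ^ l'"
        using less.IH[of l'] less.prems \<open>m = Suc l\<close> by simp
      then show ?thesis
        using eq Suc \<open>m = Suc l\<close> degree_ge_2 by (simp add: of_nat_diff algebra_simps)
    qed
  qed
qed

sublocale spherical_graph X
proof
  fix v i assume v: "v \<in> verts X"
  show "Gam X i v \<noteq> {}"
  proof (cases i)
    case 0
    then show ?thesis using Gam_0[OF conn v] by simp
  next
    case (Suc m)
    \<comment> \<open>The bound \<open>k \<ge> 2\<close> keeps all powers of \<open>k - 1\<close>
      nonzero.\<close>
    then have "real (card (Gam X i v)) \<noteq> 0"
      using card_Gam[OF v, of m] degree_ge_2 by simp
    then show ?thesis by auto
  qed
qed (rule simple conn loc_finite)+

text \<open>Dividing the double counting identity by the sphere sizes gives weights \<open>q\<close>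
  and 1 over \<open>q + 1\<close>, where \<open>q = k - 1\<close>. The identity is pointwise and
  holds for every function \<open>f\<close>.\<close>

lemma sphere_mean_recurrence:
  assumes v: "v \<in> verts X"
  shows "sphere_mean X (m + 2) f v =
    k / (real k - 1) * sphere_mean X 1 (sphere_mean X (m + 1) f) v +
    - 1 / (real k - 1) * sphere_mean X m f v"
proof -
  define q where "q = real k - 1"
  have q: "q > 0" "real k = q + 1" "real (k - 1) = q" using degree_ge_2 by (simp_all add: q_def of_nat_diff)
  have nb: "u \<in> verts X" if "u \<in> neighbours X v" for u
    using that by (simp add: neighbours_def)
  have card: "real (card (Gam X (Suc m) u)) = (q + 1) * q ^ m" if "u \<in> verts X" for u m
    using card_Gam[OF that, of m] by (simp add: q_def)
  have "sphere_mean X 1 (sphere_mean X (m + 1) f) v =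
      (\<Sum>u\<in>neighbours X v. (\<Sum>w\<in>Gam X (Suc m) u. f w) / ((q + 1) * q ^ m)) / (q + 1)"
  proof -
    have "sphere_mean X (m + 1) f u = (\<Sum>w\<in>Gam X (Suc m) u. f w) / ((q + 1) * q ^ m)"
      if "u \<in> neighbours X v" for u
      using card[OF nb[OF that], of m] by (simp add: sphere_mean_def)
    then show ?thesis
      using card_neighbours[OF v] q(2) unfolding sphere_mean_def[of X 1] Gam_1[OF v] by simp
  qed
  also have "\<dots> = ((\<Sum>w\<in>Gam X (m + 2) v. f w) + (if m = 0 then k else k - 1) * (\<Sum>w\<in>Gam X m v. f w))
      / ((q + 1) * q ^ m) / (q + 1)"
    unfolding sum_neighbours_sum_Gam[OF v, symmetric] by (simp add: sum_divide_distrib)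
  finally have eq: "sphere_mean X 1 (sphere_mean X (m + 1) f) v = \<dots>" .
  have top: "(\<Sum>w\<in>Gam X (m + 2) v. f w) = (q + 1) * q ^ Suc m * sphere_mean X (m + 2) f v"
    using card[OF v, of "Suc m"] q by (simp add: sphere_mean_def)
  \<comment> \<open>The exceptional factor \<open>k\<close> at \<open>m = 0\<close> offsets the
    exceptional size 1 of the sphere of radius 0, so one formula covers both cases.\<close>
  have bot: "(if m = 0 then k else k - 1) * (\<Sum>w\<in>Gam X m v. f w) =
      (q + 1) * q ^ m * sphere_mean X m f v"
  proof (cases m)
    case 0
    then show ?thesis using Gam_0[OF conn v] q by (simp add: sphere_mean_def)
  next
    case (Suc l)
    then show ?thesis using card[OF v, of l] q by (simp add: sphere_mean_def)
  qed
  define c where "c = (q + 1) * q ^ m"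
  have "c \<noteq> 0" using q(1) by (simp add: c_def)
  have "sphere_mean X 1 (sphere_mean X (m + 1) f) v =
      (c * (q * sphere_mean X (m + 2) f v + sphere_mean X m f v)) / c / (q + 1)"
    unfolding eq top bot c_def by (simp add: algebra_simps)
  also have "\<dots> = (q * sphere_mean X (m + 2) f v + sphere_mean X m f v) / (q + 1)"
    using \<open>c \<noteq> 0\<close> by simp
  finally show ?thesis
    unfolding q_def[symmetric] using q(1,2) by (simp add: field_simps)
qed

section \<open>Radial functions on the tree\<close>

lemma sphere_mean_1_radial:
  fixes \<phi> :: "nat \<Rightarrow> real"
  assumes v0: "v\<^sub>0 \<in> verts X" and v: "v \<in> verts X"
  shows "sphere_mean X 1 (\<lambda>w. \<phi> (gdist X v\<^sub>0 w)) v =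
    (case gdist X v\<^sub>0 v of 0 \<Rightarrow> k * \<phi> 1 | Suc n \<Rightarrow> \<phi> n + (k - 1) * \<phi> (n + 2)) / k"
proof -
  have "(\<Sum>u\<in>neighbours X v. \<phi> (gdist X v\<^sub>0 u)) = (\<Sum>u\<in>neighbours X v. \<phi> (gdist X u v\<^sub>0))"
    using gdist_sym[OF conn v0] by (intro sum.cong) (auto simp: neighbours_def)
  then show ?thesis
    using sum_neighbours_gdist[OF v v0, of \<phi>] card_neighbours[OF v] gdist_sym[OF conn v0 v]
    by (simp add: sphere_mean_def Gam_1[OF v, simplified])
qed

text \<open>The mean over neighbours preserves radial functions, and the recurrence carries this to
  every radius.\<close>

lemma sphere_mean_radial:
  assumes v0: "v\<^sub>0 \<in> verts X"
  shows "\<exists>\<psi>. \<forall>v\<in>verts X. sphere_mean X j (\<lambda>w. \<phi> (gdist X v\<^sub>0 w)) v = \<psi> (gdist X v\<^sub>0 v)"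
proof (induction j rule: less_induct)
  case (less j)
  consider "j = 0" | "j = 1" | m where "j = m + 2"
    by (metis One_nat_def add_2_eq_Suc' not0_implies_Suc)
  then show ?case
  proof cases
    case 1
    then show ?thesis using sphere_mean_0 by auto
  next
    case 2
    then show ?thesis
      using sphere_mean_1_radial[OF v0]
      by (intro exI[of _ "\<lambda>d. (case d of 0 \<Rightarrow> k * \<phi> 1 | Suc n \<Rightarrow> \<phi> n + (k - 1) * \<phi> (n + 2)) / k"]) simp
  next
    case 3
    obtain \<psi> \<chi> where
      \<psi>: "\<forall>v\<in>verts X. sphere_mean X (m + 1) (\<lambda>w. \<phi> (gdist X v\<^sub>0 w)) v = \<psi> (gdist X v\<^sub>0 v)" and
      \<chi>: "\<forall>v\<in>verts X. sphere_mean X m (\<lambda>w. \<phi> (gdist X v\<^sub>0 w)) v = \<chi> (gdist X v\<^sub>0 v)"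
      using less[of "m + 1"] less[of m] 3 by auto
    have "sphere_mean X 1 (sphere_mean X (m + 1) (\<lambda>w. \<phi> (gdist X v\<^sub>0 w))) v =
        sphere_mean X 1 (\<lambda>w. \<psi> (gdist X v\<^sub>0 w)) v" for v
    proof (rule sphere_mean_cong)
      fix w assume "w \<in> Gam X 1 v"
      then show "sphere_mean X (m + 1) (\<lambda>w. \<phi> (gdist X v\<^sub>0 w)) w = \<psi> (gdist X v\<^sub>0 w)"
        using \<psi> by (simp add: Gam_def)
    qed
    then show ?thesis
      unfolding 3
      by (intro exI[of _ "\<lambda>d. k / (real k - 1) *
          ((case d of 0 \<Rightarrow> k * \<psi> 1 | Suc n \<Rightarrow> \<psi> n + (k - 1) * \<psi> (n + 2)) / k) +
          - 1 / (real k - 1) * \<chi> d"] ballI)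
        (simp only: sphere_mean_recurrence sphere_mean_1_radial[OF v0] \<chi>)
  qed
qed

text \<open>The inner mean is constant on spheres around \<open>v\<^sub>0\<close>, so the outer mean
  changes nothing. This turns the pointwise recurrence into one for
  \<open>radial_mean\<close>.\<close>

lemma sphere_mean_eq_radial_mean:
  assumes v0: "v\<^sub>0 \<in> verts X" and v: "v \<in> verts X"
  shows "sphere_mean X j (\<lambda>w. \<phi> (gdist X v\<^sub>0 w)) v = radial_mean X v\<^sub>0 j \<phi> (gdist X v\<^sub>0 v)"
proof -
  obtain \<psi> where \<psi>: "\<And>v. v \<in> verts X \<Longrightarrow>
      sphere_mean X j (\<lambda>w. \<phi> (gdist X v\<^sub>0 w)) v = \<psi> (gdist X v\<^sub>0 v)"
    using sphere_mean_radial[OF v0] by blast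
  have "radial_mean X v\<^sub>0 j \<phi> i = sphere_mean X i (\<lambda>_. \<psi> i) v\<^sub>0" for i
    unfolding radial_mean_def by (rule sphere_mean_cong) (simp add: \<psi> Gam_def)
  then show ?thesis using \<psi>[OF v] sphere_mean_const[OF v0] by simp
qed

lemma radial_mean_recurrence:
  assumes v0: "v\<^sub>0 \<in> verts X"
  shows "radial_mean X v\<^sub>0 (j + 2) \<phi> =
    (\<lambda>i. k / (real k - 1) * radial_mean X v\<^sub>0 1 (radial_mean X v\<^sub>0 (j + 1) \<phi>) i +
      - 1 / (real k - 1) * radial_mean X v\<^sub>0 j \<phi> i)"
proof
  fix i
  obtain v where v: "v \<in> verts X" "gdist X v\<^sub>0 v = i"
    using Gam_nonempty[OF v0, of i] by (auto simp: Gam_def)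
  have "sphere_mean X 1 (sphere_mean X (j + 1) (\<lambda>w. \<phi> (gdist X v\<^sub>0 w))) v =
      sphere_mean X 1 (\<lambda>w. radial_mean X v\<^sub>0 (j + 1) \<phi> (gdist X v\<^sub>0 w)) v"
    by (intro sphere_mean_cong sphere_mean_eq_radial_mean[OF v0] subsetD[OF Gam_subset_verts])
  then show "radial_mean X v\<^sub>0 (j + 2) \<phi> i =
      k / (real k - 1) * radial_mean X v\<^sub>0 1 (radial_mean X v\<^sub>0 (j + 1) \<phi>) i +
      - 1 / (real k - 1) * radial_mean X v\<^sub>0 j \<phi> i"
    using sphere_mean_recurrence[OF v(1), of j "\<lambda>w. \<phi> (gdist X v\<^sub>0 w)"]
    by (simp only: sphere_mean_eq_radial_mean[OF v0 v(1)] v(2))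
qed

lemma produces_hypergroup: "random_walk_produces_hypergroup X"
  by (rule hypergroup_of_three_term_recurrence) (use radial_mean_recurrence in blast)

end

section \<open>The ladder\<close>

definition ladder :: "(int \<times> int) ugraph" where
  "ladder = Cay (integer_group \<times>\<times> integer_mod_group 2) {(1, 0), (-1, 0), (0, 1)}"

text \<open>Residue classes modulo 2 are represented by the integers 0 and 1, so the distance is the
  restriction of the taxicab metric to two rails.\<close>

definition ladder_dist :: "int \<times> int \<Rightarrow> int \<times> int \<Rightarrow> nat" where
  "ladder_dist v w = nat (\<bar>fst v - fst w\<bar> + \<bar>snd v - snd w\<bar>)"

lemma carrier_ladder_group:
  "carrier (integer_group \<times>\<times> integer_mod_group 2) = UNIV \<times> {0, 1}"
  by (auto simp: carrier_integer_mod_group)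

lemma verts_ladder: "verts ladder = UNIV \<times> {0, 1}"
  by (simp only: ladder_def Cay_def ugraph.sel carrier_ladder_group)

lemma ladder_quotient:
  assumes "g \<in> UNIV \<times> {0, 1}" "h \<in> UNIV \<times> {0, 1}"
  shows "inv\<^bsub>integer_group \<times>\<times> integer_mod_group 2\<^esub> g \<otimes>\<^bsub>integer_group \<times>\<times> integer_mod_group 2\<^esub> h
    \<in> {(1, 0), (-1, 0), (0, 1)} \<longleftrightarrow> ladder_dist g h = 1"
proof -
  obtain x a y b where gh: "g = (x, a)" "h = (y, b)" by (cases g, cases h)
  have ab: "a \<in> carrier (integer_mod_group 2)" "b \<in> carrier (integer_mod_group 2)"
    "a \<in> {0, 1}" "b \<in> {0, 1}"
    using assms gh by (auto simp: carrier_integer_mod_group)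
  have "inv\<^bsub>integer_group \<times>\<times> integer_mod_group 2\<^esub> g = (- x, (- a) mod 2)"
    unfolding gh using ab by (subst inv_DirProd) auto
  then show ?thesis
    using ab by (auto simp: gh ladder_dist_def)
qed

lemma edges_ladder:
  "{u, v} \<in> edges ladder \<longleftrightarrow> u \<in> verts ladder \<and> v \<in> verts ladder \<and> ladder_dist u v = 1"
proof -
  have sym: "ladder_dist g h = ladder_dist h g" for g h
    by (simp add: ladder_dist_def abs_minus_commute)
  have "edges ladder = {{g, h} | g h. g \<in> UNIV \<times> {0, 1} \<and> h \<in> UNIV \<times> {0, 1} \<and> ladder_dist g h = 1}"
    unfolding ladder_def Cay_def ugraph.sel carrier_ladder_group
    by (simp only: ladder_quotient cong: conj_cong)
  then show ?thesis
    unfolding verts_ladder by (auto simp: doubleton_eq_iff sym)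
qed

lemma neighbours_ladder:
  "v \<in> verts ladder \<Longrightarrow> neighbours ladder v = {w \<in> verts ladder. ladder_dist v w = 1}"
  by (auto simp: neighbours_def edges_ladder)

lemma ladder_descent:
  assumes "v \<in> verts ladder" "w \<in> verts ladder" "ladder_dist v w = Suc n"
  shows "\<exists>u\<in>neighbours ladder v. ladder_dist u w = n"
proof -
  obtain x a y b where vw: "v = (x, a)" "w = (y, b)" by (cases v, cases w)
  have ab: "a \<in> {0, 1}" "b \<in> {0, 1}" using assms vw by (auto simp: verts_ladder)
  \<comment> \<open>Change rails first if necessary; otherwise \<open>x \<noteq> y\<close>, and a
    horizontal step leads towards \<open>w\<close>.\<close>
  define u where "u = (if a \<noteq> b then (x, b) else if x < y then (x + 1, a) else (x - 1, a))"
  have "u \<in> neighbours ladder v \<and> ladder_dist u w = n"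
    unfolding neighbours_ladder[OF assms(1)] using ab assms(3) vw
    by (auto simp: u_def verts_ladder ladder_dist_def)
  then show ?thesis by blast
qed

lemma
  assumes "v \<in> verts ladder" "w \<in> verts ladder"
  shows gdist_ladder: "gdist ladder v w = ladder_dist v w"
    and walk_ladder: "\<exists>p. walk ladder p \<and> hd p = v \<and> last p = w"
proof -
  have D0: "ladder_dist v w = 0 \<longleftrightarrow> v = w" for v w
    by (auto simp: ladder_dist_def prod_eq_iff)
  have edge: "ladder_dist v w \<le> Suc (ladder_dist u w)"
    if "v \<in> verts ladder" "u \<in> neighbours ladder v" for u v w
    using that by (auto simp: neighbours_ladder ladder_dist_def)
  show "gdist ladder v w = ladder_dist v w" "\<exists>p. walk ladder p \<and> hd p = v \<and> last p = w"
    using gdist_eqI[of ladder ladder_dist, OF D0 edge ladder_descent assms] by blast+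
qed

text \<open>Crossing to the other rail costs one step, which leaves \<open>j - 1\<close> horizontal
  ones. For \<open>j = 1\<close> the last two points coincide, so radius 1 needs its own mean
  formula.\<close>

lemma Gam_ladder:
  assumes "a \<in> {0, 1}" "j \<ge> 1"
  shows "Gam ladder j (x, a) =
    {(x + j, a), (x - j, a), (x + (int j - 1), 1 - a), (x - (int j - 1), 1 - a)}"
    (is "_ = ?S")
proof -
  have "(y, b) \<in> Gam ladder j (x, a) \<longleftrightarrow> (y, b) \<in> ?S" for y b
  proof (cases "b \<in> {0, 1}")
    case True
    have "(y, b) \<in> Gam ladder j (x, a) \<longleftrightarrow> nat (\<bar>x - y\<bar> + \<bar>a - b\<bar>) = j"
      using assms True by (simp add: Gam_def gdist_ladder verts_ladder ladder_dist_def)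
    also have "\<dots> \<longleftrightarrow> (y, b) \<in> ?S"
    proof (cases "b = a")
      case True
      moreover have "a \<noteq> 1 - a" using assms by auto
      ultimately show ?thesis by simp linarith
    next
      case False
      then have b: "b = 1 - a" "\<bar>a - b\<bar> = 1" using assms True by auto
      show ?thesis
        using assms(2) False b by (simp only: insert_iff empty_iff prod.inject simp_thms) linarith
    qed
    finally show ?thesis .
  next
    case False
    moreover from this have "b \<noteq> a" "b \<noteq> 1 - a" using assms by auto
    ultimately show ?thesis by (simp add: Gam_def verts_ladder)
  qed
  then show ?thesis by (simp only: set_eq_iff split_paired_All) blast
qed

lemma spherical_ladder: "spherical_graph ladder"
proof
  show "simple_graph ladder"
    unfolding simple_graph_def
  proof
    fix f assume f: "f \<in> edges ladder"
    then obtain g h where gh: "f = {g, h}" by (auto simp: ladder_def Cay_def)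
    then have "g \<in> verts ladder" "h \<in> verts ladder" "ladder_dist g h = 1"
      using f edges_ladder by auto
    moreover from this have "g \<noteq> h" by (auto simp: ladder_dist_def)
    ultimately show "f \<subseteq> verts ladder \<and> card f = 2" by (simp add: gh)
  qed
  show conn: "connected_graph ladder"
    using walk_ladder by (auto simp: connected_graph_def verts_ladder)
  show "locally_finite ladder"
    unfolding locally_finite_def
  proof
    fix v assume v: "v \<in> verts ladder"
    then have "neighbours ladder v = Gam ladder 1 v"
      by (auto simp: neighbours_ladder Gam_def gdist_ladder)
    then show "finite (neighbours ladder v)"
      using v Gam_ladder[of "snd v" 1 "fst v"] by (auto simp: verts_ladder)
  qed
  fix v i assume v: "v \<in> verts ladder"
  then show "Gam ladder i v \<noteq> {}"
    using Gam_ladder[of "snd v" i "fst v"] Gam_0[OF conn v] by (cases "i = 0") (auto simp: verts_ladder)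
qed

section \<open>Spherical and radial means on the ladder\<close>

interpretation ladder: spherical_graph ladder
  by (rule spherical_ladder)

lemma sphere_mean_ladder_1:
  assumes "a \<in> {0, 1}"
  shows "sphere_mean ladder 1 f (x, a) = (f (x + 1, a) + f (x - 1, a) + f (x, 1 - a)) / 3"
proof -
  have "Gam ladder 1 (x, a) = {(x + 1, a), (x - 1, a), (x, 1 - a)}"
    using Gam_ladder[OF assms, of 1] by auto
  moreover have "a \<noteq> 1 - a" using assms by auto
  ultimately show ?thesis by (simp add: sphere_mean_def)
qed

lemma sphere_mean_ladder:
  assumes "a \<in> {0, 1}" "j \<ge> 2"
  shows "sphere_mean ladder j f (x, a) =
    (f (x + j, a) + f (x - j, a) + f (x + (int j - 1), 1 - a) + f (x - (int j - 1), 1 - a)) / 4"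
proof -
  have "a \<noteq> 1 - a" using assms by auto
  then show ?thesis using Gam_ladder[OF assms(1), of j] assms(2) by (simp add: sphere_mean_def)
qed

text \<open>On the ladder a radial function is \<open>level 0\<close> on the rail of the base point and \<open>level 1\<close> on
  the other rail, as a function of the horizontal displacement.\<close>

definition level :: "(nat \<Rightarrow> real) \<Rightarrow> int \<Rightarrow> int \<Rightarrow> real" where
  "level \<phi> b z = \<phi> (nat (\<bar>z\<bar> + b))"

lemma level_minus: "level \<phi> b (- z) = level \<phi> b z"
  by (simp add: level_def)

context
  fixes x a :: int assumes a: "a \<in> {0, 1}"
begin

lemma radial_level:
  "\<phi> (gdist ladder (x, a) (x + z, a)) = level \<phi> 0 z"
  "\<phi> (gdist ladder (x, a) (x + z, 1 - a)) = level \<phi> 1 z"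
  using a by (auto simp: gdist_ladder verts_ladder ladder_dist_def level_def)

lemma sphere_mean_level_1:
  "sphere_mean ladder 1 (\<lambda>w. \<phi> (gdist ladder (x, a) w)) (x + z, a) =
    (level \<phi> 0 (z + 1) + level \<phi> 0 (z - 1) + level \<phi> 1 z) / 3"
  "sphere_mean ladder 1 (\<lambda>w. \<phi> (gdist ladder (x, a) w)) (x + z, 1 - a) =
    (level \<phi> 1 (z + 1) + level \<phi> 1 (z - 1) + level \<phi> 0 z) / 3"
proof -
  have a': "1 - a \<in> {0, 1}" using a by auto
  show "sphere_mean ladder 1 (\<lambda>w. \<phi> (gdist ladder (x, a) w)) (x + z, a) =
      (level \<phi> 0 (z + 1) + level \<phi> 0 (z - 1) + level \<phi> 1 z) / 3"
    unfolding sphere_mean_ladder_1[OF a] radial_level[symmetric] by (simp add: algebra_simps)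
  show "sphere_mean ladder 1 (\<lambda>w. \<phi> (gdist ladder (x, a) w)) (x + z, 1 - a) =
      (level \<phi> 1 (z + 1) + level \<phi> 1 (z - 1) + level \<phi> 0 z) / 3"
    unfolding sphere_mean_ladder_1[OF a'] radial_level[symmetric] by (simp add: algebra_simps)
qed

lemma sphere_mean_level:
  assumes "j \<ge> 2"
  shows "sphere_mean ladder j (\<lambda>w. \<phi> (gdist ladder (x, a) w)) (x + z, a) =
    (level \<phi> 0 (z + j) + level \<phi> 0 (z - j) + level \<phi> 1 (z + (int j - 1)) + level \<phi> 1 (z - (int j - 1))) / 4"
    and "sphere_mean ladder j (\<lambda>w. \<phi> (gdist ladder (x, a) w)) (x + z, 1 - a) =
    (level \<phi> 1 (z + j) + level \<phi> 1 (z - j) + level \<phi> 0 (z + (int j - 1)) + level \<phi> 0 (z - (int j - 1))) / 4"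
proof -
  have a': "1 - a \<in> {0, 1}" using a by auto
  show "sphere_mean ladder j (\<lambda>w. \<phi> (gdist ladder (x, a) w)) (x + z, a) =
    (level \<phi> 0 (z + j) + level \<phi> 0 (z - j) + level \<phi> 1 (z + (int j - 1)) + level \<phi> 1 (z - (int j - 1))) / 4"
    unfolding sphere_mean_ladder[OF a assms] radial_level[symmetric] by (simp add: algebra_simps)
  show "sphere_mean ladder j (\<lambda>w. \<phi> (gdist ladder (x, a) w)) (x + z, 1 - a) =
    (level \<phi> 1 (z + j) + level \<phi> 1 (z - j) + level \<phi> 0 (z + (int j - 1)) + level \<phi> 0 (z - (int j - 1))) / 4"
    unfolding sphere_mean_ladder[OF a' assms] radial_level[symmetric] by (simp add: algebra_simps)
qed

text \<open>Every point is written with an explicit displacement from \<open>x\<close>, even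
  \<open>- 1\<close> and \<open>0\<close>, to match the formulas for sphere means in terms of
  \<open>level\<close>.\<close>

lemma radial_mean_ladder_at_1:
  "radial_mean ladder (x, a) j \<phi> 1 =
    (let f = sphere_mean ladder j (\<lambda>w. \<phi> (gdist ladder (x, a) w))
     in (f (x + 1, a) + f (x + (- 1), a) + f (x + 0, 1 - a)) / 3)"
  unfolding radial_mean_def sphere_mean_ladder_1[OF a] by (simp add: Let_def)

lemma radial_mean_ladder_at_ge_2:
  assumes "i \<ge> 2"
  shows "radial_mean ladder (x, a) j \<phi> i =
    (let f = sphere_mean ladder j (\<lambda>w. \<phi> (gdist ladder (x, a) w))
     in (f (x + int i, a) + f (x + (- int i), a) + f (x + (int i - 1), 1 - a) + f (x + (- (int i - 1)), 1 - a)) / 4)"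
  unfolding radial_mean_def sphere_mean_ladder[OF a assms] Let_def diff_conv_add_uminus ..

lemma radial_mean_ladder_1_1: "radial_mean ladder (x, a) 1 \<phi> 1 = (\<phi> 0 + 2 * \<phi> 2) / 3"
  unfolding radial_mean_ladder_at_1 Let_def sphere_mean_level_1
  by (simp add: level_def eval_nat_numeral add_divide_distrib)

lemma radial_mean_ladder_ge_2_1:
  assumes "j \<ge> 2"
  shows "radial_mean ladder (x, a) j \<phi> 1 = (\<phi> (j + 1) + \<phi> (j - 1)) / 2"
proof -
  obtain m where "j = m + 2" using assms by (metis add.commute le_Suc_ex)
  then show ?thesis
    unfolding radial_mean_ladder_at_1 Let_def sphere_mean_level[OF assms]
    by (simp add: level_def nat_add_distrib eval_nat_numeral add_divide_distrib)
qed

text \<open>Two opposite biases cancel: at distance \<open>i\<close> on the base rail two of three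
  neighbours are farther from the base point, on the other rail two of three are closer.\<close>

lemma radial_mean_ladder_1_ge_2:
  assumes "i \<ge> 2"
  shows "radial_mean ladder (x, a) 1 \<phi> i = (\<phi> (i + 1) + \<phi> (i - 1)) / 2"
proof -
  obtain m where "i = m + 2" using assms by (metis add.commute le_Suc_ex)
  then show ?thesis
    unfolding radial_mean_ladder_at_ge_2[OF assms] Let_def sphere_mean_level_1
    by (simp add: level_def nat_add_distrib eval_nat_numeral add_divide_distrib)
qed

text \<open>Of the eight terms left after reflection, four depend on \<open>i + j\<close> and are
  evaluated. The other four depend on \<open>i - j\<close>, whose sign is open, and stay in terms of
  \<open>level\<close>.\<close>

lemma radial_mean_ladder_ge_2:
  assumes "i \<ge> 2" "j \<ge> 2"
  shows "radial_mean ladder (x, a) j \<phi> i = (3 * \<phi> (i + j) + \<phi> (i + j - 2) +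
    (2 * level \<phi> 0 (int i - int j) + level \<phi> 1 (int i - int j + 1) + level \<phi> 1 (int i - int j - 1))) / 8"
proof -
  define n m where "n = int i" and "m = int j"
  have nm: "n \<ge> 2" "m \<ge> 2" using assms by (simp_all add: n_def m_def)
  \<comment> \<open>Reflection in the base point identifies the contributions of opposite
    displacements.\<close>
  have swap: "level \<phi> b (- z + y) = level \<phi> b (z - y)" "level \<phi> b (- z - y) = level \<phi> b (z + y)" for b y z
    using level_minus[of \<phi> b "z - y"] level_minus[of \<phi> b "z + y"] by simp_all
  have "radial_mean ladder (x, a) j \<phi> i = (level \<phi> 0 (n + m) + level \<phi> 0 (n - m) + level \<phi> 1 (n + (m - 1)) + level \<phi> 1 (n - (m - 1)) +
     (level \<phi> 1 (n - 1 + m) + level \<phi> 1 (n - 1 - m) + level \<phi> 0 (n - 1 + (m - 1)) + level \<phi> 0 (n - 1 - (m - 1)))) / 8"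
    unfolding radial_mean_ladder_at_ge_2[OF assms(1)] Let_def sphere_mean_level[OF assms(2)]
      n_def[symmetric] m_def[symmetric] swap by (simp add: add_divide_distrib)
  moreover have "level \<phi> 0 (n + m) = \<phi> (i + j)" "level \<phi> 1 (n + (m - 1)) = \<phi> (i + j)"
      "level \<phi> 1 (n - 1 + m) = \<phi> (i + j)" "level \<phi> 0 (n - 1 + (m - 1)) = \<phi> (i + j - 2)"
    using assms unfolding level_def n_def m_def by (auto intro!: arg_cong[where f = \<phi>])
  moreover have "n - (m - 1) = n - m + 1" "n - 1 - m = n - m - 1" "n - 1 - (m - 1) = n - m"
    by simp_all
  ultimately show ?thesis unfolding n_def m_def by simp
qed

text \<open>Away from small radii \<open>T\<^sub>m\<close> is a function of \<open>i + m\<close>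
  plus a function of \<open>i - m\<close>, and \<open>T\<^sub>1\<close> averages the values at
  \<open>i + 1\<close> and \<open>i - 1\<close>. The recurrence is then the discrete wave equation.
  The radii 0 and 1 and the index \<open>j = 0\<close> are checked separately.\<close>

lemma radial_mean_ladder_recurrence:
  "\<exists>b c. \<forall>\<phi>. radial_mean ladder (x, a) (j + 2) \<phi> = (\<lambda>i. b * radial_mean ladder (x, a) 1
     (radial_mean ladder (x, a) (j + 1) \<phi>) i + c * radial_mean ladder (x, a) j \<phi> i)"
proof -
  define T where "T = radial_mean ladder (x, a)"
  have verts: "(x, a) \<in> verts ladder" using a by (simp add: verts_ladder)
  have T_0: "T 0 \<phi> = \<phi>" and at_0: "T i \<phi> 0 = \<phi> i" for i \<phi>
    using ladder.radial_mean_0[OF verts] ladder.radial_mean_at_0[OF verts] by (simp_all add: T_def)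
  have T_1_1: "T (Suc 0) \<phi> (Suc 0) = (\<phi> 0 + 2 * \<phi> 2) / 3"
    and T_1: "i \<ge> 2 \<Longrightarrow> T (Suc 0) \<phi> i = (\<phi> (i + 1) + \<phi> (i - 1)) / 2"
    and T_at_1: "i \<ge> 2 \<Longrightarrow> T i \<phi> (Suc 0) = (\<phi> (i + 1) + \<phi> (i - 1)) / 2" for i \<phi>
    using radial_mean_ladder_1_1[of \<phi>] radial_mean_ladder_1_ge_2[of i \<phi>] radial_mean_ladder_ge_2_1[of i \<phi>]
    by (simp_all add: T_def)
  \<comment> \<open>\<open>G\<close> collects the terms depending on \<open>i - m\<close>; it is
    even in \<open>z\<close>.\<close>
  define G where "G \<phi> z = 2 * level \<phi> 0 z + level \<phi> 1 (z + 1) + level \<phi> 1 (z - 1)" for \<phi> z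
  have G_pos: "G \<phi> (1 + int m) = 3 * \<phi> (m + 1) + \<phi> (m + 3)" for \<phi> m
    by (simp add: G_def level_def nat_add_distrib eval_nat_numeral)
  have G_neg: "G \<phi> (- 1 - int m) = 3 * \<phi> (m + 1) + \<phi> (m + 3)" for \<phi> m
  proof -
    have "G \<phi> (- z) = G \<phi> z" for z
      using level_minus[of \<phi> 0 z] level_minus[of \<phi> 1 "z - 1"] level_minus[of \<phi> 1 "z + 1"]
      by (simp add: G_def)
    moreover have "- 1 - int m = - (1 + int m)" by simp
    ultimately show ?thesis using G_pos by metis
  qed
  \<comment> \<open>The formula for radii at least 2 also covers the case where just one of
    \<open>i\<close> and \<open>m\<close> is 1; it fails when both are.\<close>
  have T: "T m \<phi> i = (3 * \<phi> (i + m) + \<phi> (i + m - 2) + G \<phi> (int i - int m)) / 8"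
    if "i \<ge> 1" "m \<ge> 1" "i \<ge> 2 \<or> m \<ge> 2" for i m \<phi>
  proof -
    have "i \<ge> 2 \<and> m \<ge> 2 \<or> i = 1 \<and> m = (m - 2) + 2 \<or> i = (i - 2) + 2 \<and> m = 1"
      using that by linarith
    then consider "i \<ge> 2" "m \<ge> 2" | l where "i = 1" "m = l + 2" | l where "i = l + 2" "m = 1"
      by blast
    then show ?thesis
    proof cases
      case 1
      then show ?thesis using radial_mean_ladder_ge_2[OF 1] by (simp add: T_def G_def)
    next
      case 2
      then show ?thesis using T_at_1[of m \<phi>] G_neg[of \<phi> l]
        by (simp add: eval_nat_numeral)
    next
      case 3
      then show ?thesis using T_1[of i \<phi>] G_pos[of \<phi> l]
        by (simp add: eval_nat_numeral)
    qed
  qed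
  show ?thesis
  proof (cases "j = 0")
    case True
    \<comment> \<open>Evaluation at \<open>i = 0\<close>, where \<open>T 1 (T 1 \<phi>)\<close>
      takes the value \<open>(\<phi> 0 + 2 * \<phi> 2) / 3\<close>, forces the coefficients.\<close>
    have "T 2 \<phi> i = 3 / 2 * T 1 (T 1 \<phi>) i + - 1 / 2 * T 0 \<phi> i" for \<phi> i
    proof -
      have "i = 0 \<or> i = 1 \<or> i = 2 \<or> i = (i - 3) + 3" by linarith
      then consider "i = 0" | "i = 1" | "i = 2" | l where "i = l + 3" by blast
      then show ?thesis
      proof cases
        case 1
        then show ?thesis by (simp add: add_divide_distrib at_0 T_0 T_1_1)
      next
        case 2
        then show ?thesis by (simp add: add_divide_distrib at_0 T_0 T_1_1 T_1 T_at_1)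
      next
        case 3
        have "G \<phi> 0 = 2 * \<phi> 0 + 2 * \<phi> 2" by (simp add: G_def level_def eval_nat_numeral)
        with 3 show ?thesis using T[of 2 2 \<phi>] by (simp add: add_divide_distrib T_0 T_1_1 T_1)
      next
        case 4
        then show ?thesis using G_pos[of \<phi> l] T[of i 2 \<phi>]
          by (simp add: add_divide_distrib T_0 T_1 eval_nat_numeral)
      qed
    qed
    then have "T (j + 2) \<phi> i = 3 / 2 * T 1 (T (j + 1) \<phi>) i + - 1 / 2 * T j \<phi> i" for \<phi> i
      by (simp add: True numeral_2_eq_2)
    then show ?thesis unfolding T_def fun_eq_iff by blast
  next
    case False
    then obtain m where j: "j = m + 1" by (metis Suc_eq_plus1 not0_implies_Suc)
    \<comment> \<open>Again \<open>i = 0\<close> dictates the coefficients: there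
      \<open>T 1 (T (j + 1) \<phi>)\<close> is the average of \<open>\<phi> (j + 2)\<close> and
      \<open>\<phi> j\<close>.\<close>
    have "T (j + 2) \<phi> i = 2 * T 1 (T (j + 1) \<phi>) i + - 1 * T j \<phi> i" for \<phi> i
    proof -
      have "i = 0 \<or> i = 1 \<or> i = (i - 2) + 2" by linarith
      then consider "i = 0" | "i = 1" | l where "i = l + 2" by blast
      then show ?thesis
      proof cases
        case 1
        then show ?thesis using j by (simp add: add_divide_distrib at_0 T_at_1)
      next
        case 2
        \<comment> \<open>At \<open>i = 1\<close> the operator \<open>T 1\<close> looks at radius 2,
          so \<open>G\<close> is needed at \<open>2 - (j + 1)\<close>, which is 0 for
          \<open>j = 1\<close> and negative for larger \<open>j\<close>.\<close>
        show ?thesis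
        proof (cases m)
          case 0
          have "G \<phi> 0 = 2 * \<phi> 0 + 2 * \<phi> 2" by (simp add: G_def level_def eval_nat_numeral)
          then show ?thesis using 0 2 j T[of 2 2 \<phi>]
            by (simp add: add_divide_distrib at_0 T_1_1 T_at_1 eval_nat_numeral)
        next
          case (Suc l)
          then show ?thesis using 2 j G_neg[of \<phi> l] T[of 2 "j + 1" \<phi>]
            by (simp add: add_divide_distrib at_0 T_1_1 T_at_1 eval_nat_numeral)
        qed
      next
        case 3
        then show ?thesis using j T[of i "j + 2" \<phi>] T[of "i + 1" "j + 1" \<phi>] T[of "i - 1" "j + 1" \<phi>] T[of i j \<phi>]
          by (simp add: add_divide_distrib T_1)
      qed
    qed
    then show ?thesis unfolding T_def fun_eq_iff by blast
  qed
qed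

end

lemma ladder_produces_hypergroup: "random_walk_produces_hypergroup ladder"
proof (rule ladder.hypergroup_of_three_term_recurrence)
  fix v\<^sub>0 j assume "v\<^sub>0 \<in> verts ladder"
  then obtain x a where "v\<^sub>0 = (x, a)" "a \<in> {0, 1}" by (auto simp: verts_ladder)
  then show "\<exists>b c. \<forall>\<phi>. radial_mean ladder v\<^sub>0 (j + 2) \<phi> = (\<lambda>i. b * radial_mean ladder v\<^sub>0 1
      (radial_mean ladder v\<^sub>0 (j + 1) \<phi>) i + c * radial_mean ladder v\<^sub>0 j \<phi> i)"
    using radial_mean_ladder_recurrence by simp
qed

theorem theorem1p1:
  shows "(\<forall>k\<ge>2. \<forall>X :: 'v ugraph. infinite_regular_tree k X \<longrightarrow>
            random_walk_produces_hypergroup X) \<and>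
         random_walk_produces_hypergroup
           (Cay (integer_group \<times>\<times> integer_mod_group 2) {(1, 0), (-1, 0), (0, 1)})"
  using regular_tree.produces_hypergroup ladder_produces_hypergroup
  by (auto simp: regular_tree_def ladder_def)

end
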